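(* Let $X$, $Y$, $X'$ be independent, with $X$ and $X'$ distributed according to $\mathbb P$ and $Y$ distributed according to $\tilde{\mathbb P}$. Suppose that $(\delta_n)$ is a sequence of positive numbers with $\delta_n\to0$ as $n\to\infty$ such that $\frac{\log n}{n\delta_n^2}\to0$. Then, in $(\mathbb P\otimes\tilde{\mathbb P}\otimes\mathbb P)$-probability, $$\lim_{n\to\infty}\frac{1}{n\delta_n}\log\frac{W_n^{\delta_n}(X|Y)}{W_n^{\delta_n}(X|X')}=\mathbf s(\mathbb P|\tilde{\mathbb P}).$$
   Context: Let $A$ be a finite set, $p(x,y)$ the transition matrix of an irreducible discrete-time Markov chain on $A$ with $p(x,x)=0$ for all $x$, and $c,\tilde c:A\to(0,\infty)$. Consider the continuous-time Markov chains on $A$ with generators $$Lf(x)=\sum_{y\in A}c(x)p(x,y)(f(y)-f(x)),\qquad \tilde Lf(x)=\sum_{y\in A}\tilde c(x)p(x,y)(f(y)-f(x)),$$ with unique stationary distributions $\mu$ and $\tilde\mu$. $\mathbb P$ (resp. $\tilde{\mathbb P}$) is the path-space law of the chain with generator $L$ (resp. $\tilde L$) started from $\mu$ (resp. $\tilde\mu$). Waiting times: for $\delta>0$ and $n\ge 1$, $$W_n^\delta(X|Y)=\inf\{k\ge 1:(X_{\delta},X_{2\delta},\dots,X_{n\delta})=(Y_{(k+1)\delta},\dots,Y_{(k+n)\delta})\}$$ (with $\inf\emptyset=\infty$), and $W_n^\delta(X|X')$ is defined in the same way with $Y$ replaced by $X'$. Relative entropy per unit time: $$\mathbf s(\mathbb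 P|\tilde{\mathbb P})=\sum_{x\in A}\mu(x)c(x)\log\frac{c(x)}{\tilde c(x)}-\sum_{x\in A}\mu(x)(c(x)-\tilde c(x)).$$ *)

theory Defs
  imports "HOL-Probability.Probability"
begin

text \<open>
  The finite state space is the type \<open>'a::finite\<close>; \<open>p x\<close> is row \<open>x\<close> of the transition matrix,
  so \<open>pmf (p x) y\<close> is the matrix entry at \<open>(x, y)\<close>.
\<close>

definition n_step :: "('a \<Rightarrow> 'a pmf) \<Rightarrow> nat \<Rightarrow> 'a \<Rightarrow> 'a pmf" where
  "n_step p n x = ((\<lambda>\<nu>. bind_pmf \<nu> p) ^^ n) (return_pmf x)"

definition irreducible_chain :: "('a \<Rightarrow> 'a pmf) \<Rightarrow> bool" where
  "irreducible_chain p \<longleftrightarrow> (\<forall>x y. \<exists>n. pmf (n_step p n x) y > 0)"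

definition generator ::
  "('a::finite \<Rightarrow> 'a pmf) \<Rightarrow> ('a \<Rightarrow> real) \<Rightarrow> ('a \<Rightarrow> real) \<Rightarrow> 'a \<Rightarrow> real" where
  "generator p c f x = (\<Sum>y\<in>UNIV. c x * pmf (p x) y * (f y - f x))"

text \<open>The semigroup \<open>exp (t L)\<close>; the series converges since the state space is finite.\<close>

definition markov_semigroup ::
  "(('a \<Rightarrow> real) \<Rightarrow> 'a \<Rightarrow> real) \<Rightarrow> real \<Rightarrow> ('a \<Rightarrow> real) \<Rightarrow> 'a \<Rightarrow> real" where
  "markov_semigroup L t f x = (\<Sum>k. t ^ k / fact k * (L ^^ k) f x)"

definition transition_prob ::
  "(('a \<Rightarrow> real) \<Rightarrow> 'a \<Rightarrow> real) \<Rightarrow> real \<Rightarrow> 'a \<Rightarrow> 'a \<Rightarrow> real" where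
  "transition_prob L t x y = markov_semigroup L t (indicator {y}) x"

definition stationary :: "(('a::finite \<Rightarrow> real) \<Rightarrow> 'a \<Rightarrow> real) \<Rightarrow> 'a pmf \<Rightarrow> bool" where
  "stationary L \<mu> \<longleftrightarrow>
     (\<forall>t\<ge>0. \<forall>y. (\<Sum>x\<in>UNIV. pmf \<mu> x * transition_prob L t x y) = pmf \<mu> y)"

text \<open>
  Paths are right-continuous with left limits on \<open>[0, \<infinity>)\<close>. The state space being discrete,
  convergence means being eventually constant. Off \<open>[0, \<infinity>)\<close> paths are \<open>undefined\<close>.
\<close>

definition cadlag_paths :: "(real \<Rightarrow> 'a) set" where
  "cadlag_paths =
     {\<omega> \<in> extensional {0..}.
        (\<forall>t\<ge>0. \<forall>\<^sub>F s in at_right t. \<omega> s = \<omega> t) \<and>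
        (\<forall>t>0. \<exists>a. \<forall>\<^sub>F s in at_left t. \<omega> s = a)}"

definition path_space :: "(real \<Rightarrow> 'a) measure" where
  "path_space = restrict_space (PiM {0..} (\<lambda>_. count_space UNIV)) cadlag_paths"

text \<open>
  \<open>P\<close> is the law on path space of the Markov chain with generator \<open>L\<close> and initial distribution \<open>\<mu>\<close>.
  It is determined by its finite-dimensional distributions.
\<close>

definition markov_path_law ::
  "(('a \<Rightarrow> real) \<Rightarrow> 'a \<Rightarrow> real) \<Rightarrow> 'a pmf \<Rightarrow> (real \<Rightarrow> 'a) measure \<Rightarrow> bool" where
  "markov_path_law L \<mu> P \<longleftrightarrow>
     prob_space P \<and> sets P = sets path_space \<and>
     (\<forall>(n::nat) (t::nat \<Rightarrow> real) (x::nat \<Rightarrow> 'a).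
        t 0 = 0 \<longrightarrow> (\<forall>i<n. t i \<le> t (Suc i)) \<longrightarrow>
        measure P {\<omega> \<in> space P. \<forall>i\<le>n. \<omega> (t i) = x i} =
          pmf \<mu> (x 0) * (\<Prod>i<n. transition_prob L (t (Suc i) - t i) (x i) (x (Suc i))))"

text \<open>The infimum of the empty set in \<open>enat\<close> is \<open>\<infinity>\<close>.\<close>

definition waiting_time :: "real \<Rightarrow> nat \<Rightarrow> (real \<Rightarrow> 'a) \<Rightarrow> (real \<Rightarrow> 'a) \<Rightarrow> enat" where
  "waiting_time \<delta> n x y =
     Inf (enat ` {k. 1 \<le> k \<and> (\<forall>i\<in>{1..n}. x (real i * \<delta>) = y (real (k + i) * \<delta>))})"

definition relative_entropy_rate ::
  "'a::finite pmf \<Rightarrow> ('a \<Rightarrow> real) \<Rightarrow> ('a \<Rightarrow> real) \<Rightarrow> real" where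
  "relative_entropy_rate \<mu> c c' =
     (\<Sum>x\<in>UNIV. pmf \<mu> x * c x * ln (c x / c' x)) - (\<Sum>x\<in>UNIV. pmf \<mu> x * (c x - c' x))"

text \<open>
  Convergence in probability of \<open>a\<^sub>n * log (V\<^sub>n / W\<^sub>n)\<close> to \<open>l\<close> for extended-valued \<open>V\<^sub>n\<close>, \<open>W\<^sub>n\<close>.
  Outcomes with \<open>V\<^sub>n = \<infinity>\<close> or \<open>W\<^sub>n = \<infinity>\<close>, where \<open>the_enat\<close> is meaningless, count as deviations from
  the limit.
\<close>

definition log_ratio_tendsto_in_prob ::
  "'b measure \<Rightarrow> (nat \<Rightarrow> real) \<Rightarrow> (nat \<Rightarrow> 'b \<Rightarrow> enat) \<Rightarrow> (nat \<Rightarrow> 'b \<Rightarrow> enat) \<Rightarrow> real \<Rightarrow> bool" where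
  "log_ratio_tendsto_in_prob M a V W l \<longleftrightarrow>
     (\<forall>\<epsilon>>0. (\<lambda>n. measure M {\<omega> \<in> space M. V n \<omega> = \<infinity> \<or> W n \<omega> = \<infinity> \<or>
        \<bar>a n * ln (real (the_enat (V n \<omega>)) / real (the_enat (W n \<omega>))) - l\<bar> > \<epsilon>}) \<longlonglongrightarrow> 0)"

end

theory Submission imports Defs begin

text \<open>
  For a fixed word \<open>a\<close> of length \<open>n\<close> with stationary cylinder probability \<open>w\<close>, the waiting time is
  \<open>1 / w\<close> up to a factor \<open>exp (\<plusminus> \<epsilon> n \<delta>)\<close>: the union bound gives the lower estimate, and for the
  upper one the windows of length \<open>n\<close> are separated by gaps of fixed duration, so that each of them
  matches \<open>a\<close> with conditional probability at least \<open>\<kappa> w\<close>. Hence the ratio of waiting times is governed by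
  the log-likelihood ratio of the two discretized chains along \<open>X\<close>, an additive functional of
  \<open>f\<^sub>\<delta> (x, y) = ln (p\<^sub>\<delta> (x, y) / p'\<^sub>\<delta> (x, y))\<close>. As \<open>\<delta> \<rightarrow> 0\<close>, \<open>f\<^sub>\<delta>\<close> stays bounded (both kernels vanish to the same
  order, the graph distance from \<open>x\<close> to \<open>y\<close>), its mean is \<open>\<delta> s + o(\<delta>)\<close>, and by Doeblin's condition
  the variance of the sum is \<open>O(n \<delta>)\<close>, which is negligible against \<open>(n \<delta>)\<^sup>2\<close>.
\<close>

section \<open>Small-time behaviour of the transition probabilities\<close>

text \<open>Neither waiting time alone has a logarithm of order \<open>n * \<delta>\<close>: a jump
  costs about ln (1 / \<delta>), so the entropy of the discretized chain per unit time diverges as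
  \<delta> tends to 0. Only the ratio has a limit, because both kernels carry the same powers of
  \<delta>, which cancel in the log-likelihood ratio. So no asymptotics of a single word probability
  is used; the waiting time is compared with the weight of the very word that \<open>X\<close>
  produces, uniformly in the word. The obstacle is that the one-step kernel tends to the identity,
  so there is no uniform mixing rate per grid step. Mixing is therefore measured over a fixed time
  \<open>u\<close> at which both kernels are positive. It costs about u / \<delta> grid steps, both
  as the gap between windows and as the correlation length in the variance, where covariances of
  size \<delta>^2 over u / \<delta> steps again give O(\<delta>) per step. A window with its gap has
  length of order n, so n must be negligible against exp (\<epsilon> n \<delta>); the rate
  assumption supplies ln n = o(n \<delta>).\<close>

lemma generator_power_bound:
  fixes f :: "'a::finite \<Rightarrow> real"
  assumes c: "\<And>x. 0 \<le> c x" "\<And>x. c x \<le> K" and f: "\<And>x. \<bar>f x\<bar> \<le> 1"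
  shows "\<bar>(generator p c ^^ k) f x\<bar> \<le> (2 * K) ^ k"
proof (induction k arbitrary: x)
  case 0
  then show ?case using f by simp
next
  case (Suc k)
  let ?g = "(generator p c ^^ k) f"
  have K: "0 \<le> K" using c order_trans by blast
  have "\<bar>generator p c ?g x\<bar> \<le> (\<Sum>y\<in>UNIV. c x * pmf (p x) y * (2 * (2 * K) ^ k))"
    unfolding generator_def[of p c ?g]
  proof (rule order_trans[OF sum_abs sum_mono])
    fix y
    have "\<bar>?g y - ?g x\<bar> \<le> 2 * (2 * K) ^ k" using Suc[of x] Suc[of y] by linarith
    then show "\<bar>c x * pmf (p x) y * (?g y - ?g x)\<bar> \<le> c x * pmf (p x) y * (2 * (2 * K) ^ k)"
      using c(1)[of x] by (simp add: abs_mult mult_left_mono)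
  qed
  also have "\<dots> = c x * (2 * (2 * K) ^ k)"
    by (simp add: sum_pmf_eq_1 flip: sum_distrib_left sum_distrib_right)
  also have "\<dots> \<le> K * (2 * (2 * K) ^ k)" using c K by (intro mult_right_mono) auto
  finally show ?case by (simp add: mult_ac)
qed

text \<open>Taylor coefficients in \<open>t\<close> of the transition probability: they turn the
  semigroup into a scalar power series for each pair of states.\<close>

definition gen_coeff :: "('a::finite \<Rightarrow> 'a pmf) \<Rightarrow> ('a \<Rightarrow> real) \<Rightarrow> 'a \<Rightarrow> 'a \<Rightarrow> nat \<Rightarrow> real" where
  "gen_coeff p c x y k = (generator p c ^^ k) (indicator {y}) x / fact k"

lemma transition_prob_powser:
  "transition_prob (generator p c) t x y = (\<Sum>k. gen_coeff p c x y k * t ^ k)"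
  by (simp add: transition_prob_def markov_semigroup_def gen_coeff_def mult_ac)

lemma summable_gen_coeff:
  assumes c: "\<forall>x. 0 < c x"
  shows "summable (\<lambda>k. gen_coeff p c x y k * t ^ k)"
proof (rule summable_comparison_test)
  define K where "K = Max (range c)"
  have K: "c x \<le> K" for x by (simp add: K_def)
  show "\<exists>N. \<forall>n\<ge>N. norm (gen_coeff p c x y n * t ^ n) \<le> inverse (fact n) *\<^sub>R (2 * K * \<bar>t\<bar>) ^ n"
  proof (intro exI allI impI)
    fix n
    have "\<bar>(generator p c ^^ n) (indicator {y}) x\<bar> \<le> (2 * K) ^ n"
      using K c by (intro generator_power_bound) (auto simp: indicator_def less_imp_le)
    then show "norm (gen_coeff p c x y n * t ^ n) \<le> inverse (fact n) *\<^sub>R (2 * K * \<bar>t\<bar>) ^ n"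
      by (simp add: gen_coeff_def abs_mult power_mult_distrib power_abs divide_simps mult_right_mono)
  qed
  show "summable (\<lambda>n. inverse (fact n) *\<^sub>R (2 * K * \<bar>t\<bar>) ^ n)"
    by (rule summable_exp_generic)
qed

text \<open>The vanishing coefficients let \<open>t ^ d\<close> be factored out of the series, and
  the remaining power series is continuous at 0.\<close>

lemma transition_prob_leading_term:
  assumes c: "\<forall>x. 0 < c x" and z: "\<And>k. k < d \<Longrightarrow> gen_coeff p c x y k = 0"
  shows "((\<lambda>t. transition_prob (generator p c) t x y / t ^ d) \<longlongrightarrow> gen_coeff p c x y d) (at_right 0)"
proof -
  let ?a = "gen_coeff p c x y"
  have shift: "transition_prob (generator p c) t x y = t ^ d * (\<Sum>k. ?a (k + d) * t ^ k)" for t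
  proof -
    have "(\<Sum>k. ?a k * t ^ k) = (\<Sum>k. ?a (k + d) * t ^ (k + d)) + (\<Sum>k<d. ?a k * t ^ k)"
      by (rule suminf_split_initial_segment[OF summable_gen_coeff[OF c]])
    also have "(\<Sum>k<d. ?a k * t ^ k) = 0" using z by (intro sum.neutral) auto
    also have "(\<Sum>k. ?a (k + d) * t ^ (k + d)) = (\<Sum>k. t ^ d * (?a (k + d) * t ^ k))"
      by (simp add: power_add mult_ac)
    also have "\<dots> = t ^ d * (\<Sum>k. ?a (k + d) * t ^ k)"
    proof (cases "t = 0 \<and> d > 0")
      case True then show ?thesis by (simp add: power_0_left)
    next
      case False
      have "summable (\<lambda>k. ?a (k + d) * t ^ k)"
      proof (cases "t = 0")
        case True then show ?thesis by (auto intro: summable_comparison_test'[of "\<lambda>_. 0" 1])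
      next
        case f: False
        have "summable (\<lambda>k. inverse (t ^ d) * (?a (k + d) * t ^ (k + d)))"
          by (intro summable_mult summable_ignore_initial_segment summable_gen_coeff c)
        then show ?thesis using f by (simp add: power_add field_simps)
      qed
      then show ?thesis by (rule suminf_mult)
    qed
    finally show ?thesis by (simp add: transition_prob_powser)
  qed
  \<comment> \<open>Convergence at the single point 1 gives radius of convergence at least 1, enough
    for continuity at 0.\<close>
  have "summable (\<lambda>k. ?a (k + d) * 1 ^ k)"
    using summable_ignore_initial_segment[OF summable_gen_coeff[OF c, of p x y 1], of d] by simp
  then have "isCont (\<lambda>t. \<Sum>k. ?a (k + d) * t ^ k) 0"
    by (rule isCont_powser) simp
  then have "((\<lambda>t. \<Sum>k. ?a (k + d) * t ^ k) \<longlongrightarrow> ?a d) (at_right 0)"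
    unfolding isCont_def by (auto intro: filterlim_mono[OF _ order_refl at_le])
  then show ?thesis
    by (rule Lim_transform_eventually)
      (rule eventually_mono[OF eventually_at_right_less[of 0]], simp add: shift)
qed

lemma transition_prob_has_derivative_0:
  assumes c: "\<forall>x. 0 < c x"
  shows "((\<lambda>t. transition_prob (generator p c) t x y) has_real_derivative generator p c (indicator {y}) x) (at 0)"
proof -
  have "((\<lambda>t. \<Sum>k. gen_coeff p c x y k * t ^ k) has_real_derivative
      (\<Sum>k. diffs (gen_coeff p c x y) k * 0 ^ k)) (at 0)"
    by (rule termdiffs_strong[where K=1]) (use summable_gen_coeff[OF c, where t=1] in auto)
  then show ?thesis
    unfolding powser_zero by (simp add: transition_prob_powser[abs_def] diffs_def) (simp add: gen_coeff_def)
qed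

lemma transition_prob_0: "transition_prob (generator p c) 0 x y = indicator {y} x"
  unfolding transition_prob_powser powser_zero by (simp add: gen_coeff_def)

lemma generator_indicator:
  fixes x y :: "'a::finite"
  assumes "pmf (p x) x = 0"
  shows "generator p c (indicator {y}) x = (if x = y then - c x else c x * pmf (p x) y)"
proof -
  have "generator p c (indicator {y}) x =
      (\<Sum>z\<in>UNIV. c x * (pmf (p x) z * indicator {y} z)) - (\<Sum>z\<in>UNIV. c x * pmf (p x) z * indicator {y} x)"
    unfolding generator_def by (simp add: sum_subtractf algebra_simps)
  also have "\<dots> = c x * pmf (p x) y - c x * indicator {y} x"
    by (simp add: sum_pmf_eq_1 indicator_def if_distrib[of "\<lambda>u. _ * u"] sum.delta cong: if_cong
        flip: sum_distrib_left sum_distrib_right)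
  finally show ?thesis using assms by auto
qed

section \<open>Graph distance as the order of vanishing of the kernel\<close>

lemma n_step_Suc_left: "n_step p (Suc n) x = bind_pmf (p x) (n_step p n)"
proof (induction n)
  case 0
  then show ?case by (simp add: n_step_def bind_return_pmf bind_return_pmf')
next
  case (Suc n)
  have "n_step p (Suc (Suc n)) x = bind_pmf (n_step p (Suc n) x) p" by (simp add: n_step_def)
  also have "\<dots> = bind_pmf (p x) (n_step p (Suc n))"
    unfolding Suc bind_assoc_pmf by (intro bind_pmf_cong refl) (simp add: n_step_def)
  finally show ?case .
qed

text \<open>\<open>n_step\<close> appends steps at the end, whereas powers of the generator act on
  the starting state; the induction over those powers therefore needs a decomposition by the first
  step.\<close>

lemma pmf_n_step_Suc_pos_iff:
  "pmf (n_step p (Suc n) x) y > 0 \<longleftrightarrow> (\<exists>z. pmf (p x) z > 0 \<and> pmf (n_step p n z) y > 0)"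
  by (auto simp: pmf_positive_iff n_step_Suc_left)

text \<open>Length of a shortest path from \<open>x\<close> to \<open>y\<close>, with value 0 for
  \<open>x = y\<close>; the \<open>LEAST\<close> is meaningful once the chain is irreducible. It
  depends on \<open>p\<close> only, hence is common to all rate functions.\<close>

definition chain_dist :: "('a \<Rightarrow> 'a pmf) \<Rightarrow> 'a \<Rightarrow> 'a \<Rightarrow> nat" where
  "chain_dist p x y = (LEAST n. pmf (n_step p n x) y > 0)"

text \<open>Applying the generator once more looks one step ahead. As long as the current power
  vanishes at \<open>x\<close>, only the neighbours contribute; they are at distance at least
  \<open>chain_dist p x y - 1\<close>, so their values are 0, or positive exactly for a neighbour on
  a shortest path. Both claims go into one induction, since positivity of the sum needs the
  vanishing at all other neighbours.\<close>

lemma generator_power_chain_dist: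
  assumes irr: "irreducible_chain p" and c: "\<forall>x. 0 < c x"
  shows "(k < chain_dist p x y \<longrightarrow> (generator p c ^^ k) (indicator {y}) x = 0) \<and>
         (k = chain_dist p x y \<longrightarrow> (generator p c ^^ k) (indicator {y}) x > 0)"
proof (induction k arbitrary: x)
  case 0
  have "chain_dist p x y = 0 \<Longrightarrow> pmf (n_step p 0 x) y > 0"
    using irr unfolding irreducible_chain_def chain_dist_def by (metis LeastI)
  moreover have "chain_dist p x y = 0" if "x = y"
    unfolding chain_dist_def using that by (intro Least_eq_0) (simp add: n_step_def)
  ultimately show ?case by (auto simp: n_step_def indicator_def split: if_splits)
next
  case (Suc k)
  let ?g = "(generator p c ^^ k) (indicator {y})"
  have step: "k \<le> chain_dist p z y" if "Suc k \<le> chain_dist p x y" "pmf (p x) z > 0" for z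
  proof (rule ccontr)
    assume "\<not> k \<le> chain_dist p z y"
    moreover have "pmf (n_step p (chain_dist p z y) z) y > 0"
      using irr unfolding irreducible_chain_def chain_dist_def by (metis LeastI)
    then have "pmf (n_step p (Suc (chain_dist p z y)) x) y > 0"
      using that(2) pmf_n_step_Suc_pos_iff by metis
    then have "chain_dist p x y \<le> Suc (chain_dist p z y)"
      unfolding chain_dist_def[of p x y] by (rule Least_le)
    ultimately show False using that(1) by simp
  qed
  have expand: "(generator p c ^^ Suc k) (indicator {y}) x = (\<Sum>z\<in>UNIV. c x * pmf (p x) z * ?g z)"
    if "Suc k \<le> chain_dist p x y"
    using Suc[of x] that unfolding funpow.simps comp_def generator_def[of p c "(generator p c ^^ k) (indicator {y})" for k] by simp
  have nonneg: "0 \<le> ?g z" if "Suc k \<le> chain_dist p x y" "pmf (p x) z > 0" for z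
    using Suc[of z] step[OF that] by (cases "k = chain_dist p z y") auto
  show ?case
  proof (intro conjI impI)
    assume l: "Suc k < chain_dist p x y"
    have "?g z = 0" if "pmf (p x) z > 0" for z
    proof -
      have "k \<noteq> chain_dist p z y"
      proof
        assume "k = chain_dist p z y"
        then have "pmf (n_step p k z) y > 0"
          using irr unfolding irreducible_chain_def chain_dist_def by (metis LeastI)
        then have "pmf (n_step p (Suc k) x) y > 0" using that pmf_n_step_Suc_pos_iff by metis
        then have "chain_dist p x y \<le> Suc k"
          unfolding chain_dist_def[of p x y] by (rule Least_le)
        with l show False by simp
      qed
      with step[of z] that l Suc[of z] show ?thesis by auto
    qed
    then have "pmf (p x) z = 0 \<or> ?g z = 0" for z
      using pmf_nonneg[of "p x" z] unfolding less_le by metis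
    then show "(generator p c ^^ Suc k) (indicator {y}) x = 0"
      using l by (subst expand) (auto intro!: sum.neutral)
  next
    assume l: "Suc k = chain_dist p x y"
    have "pmf (n_step p (Suc k) x) y > 0"
      using irr unfolding irreducible_chain_def l chain_dist_def by (metis LeastI)
    then obtain z where z: "pmf (p x) z > 0" "pmf (n_step p k z) y > 0"
      using pmf_n_step_Suc_pos_iff by metis
    then have "chain_dist p z y \<le> k" unfolding chain_dist_def by (intro Least_le)
    with step[of z] l z have "k = chain_dist p z y" by simp
    then have "0 < ?g z" using Suc[of z] by auto
    then have "0 < c x * pmf (p x) z * ?g z" using c z by simp
    moreover have "0 \<le> c x * pmf (p x) z * ?g z" for z
      using nonneg[of z] l spec[OF c, of x] by (cases "pmf (p x) z > 0") (auto simp: less_imp_le less_le)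
    ultimately show "0 < (generator p c ^^ Suc k) (indicator {y}) x"
      using l by (subst expand) (auto intro!: sum_pos2[of _ z])
  qed
qed

lemma transition_prob_leading_term_chain_dist:
  assumes irr: "irreducible_chain p" and c: "\<forall>x. 0 < c x"
  shows "((\<lambda>t. transition_prob (generator p c) t x y / t ^ chain_dist p x y)
      \<longlongrightarrow> gen_coeff p c x y (chain_dist p x y)) (at_right 0)"
    and "gen_coeff p c x y (chain_dist p x y) > 0"
proof -
  have *: "k < chain_dist p x y \<Longrightarrow> gen_coeff p c x y k = 0"
    "gen_coeff p c x y (chain_dist p x y) > 0" for k
    using generator_power_chain_dist[OF irr c, of _ x y] by (simp_all add: gen_coeff_def)
  show "((\<lambda>t. transition_prob (generator p c) t x y / t ^ chain_dist p x y)
      \<longlongrightarrow> gen_coeff p c x y (chain_dist p x y)) (at_right 0)"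
    by (rule transition_prob_leading_term[OF c *(1)])
  show "gen_coeff p c x y (chain_dist p x y) > 0" by (rule *(2))
qed

lemma eventually_transition_prob_pos:
  assumes irr: "irreducible_chain p" and c: "\<forall>x. 0 < c x"
  shows "\<forall>\<^sub>F t in at_right 0. \<forall>x y. transition_prob (generator p c) t x y > 0"
proof -
  have "\<forall>\<^sub>F t in at_right 0. transition_prob (generator p c) t x y > 0" for x y
    using order_tendstoD(1)[OF transition_prob_leading_term_chain_dist[OF irr c]]
      eventually_at_right_less[of 0]
    by eventually_elim (auto simp: zero_less_divide_iff)
  then show ?thesis by (simp add: eventually_all_finite)
qed

section \<open>Limits of the one-step log-likelihood ratio\<close>

definition log_ratio ::
  "('a::finite \<Rightarrow> 'a pmf) \<Rightarrow> ('a \<Rightarrow> real) \<Rightarrow> ('a \<Rightarrow> real) \<Rightarrow> real \<Rightarrow> 'a \<Rightarrow> 'a \<Rightarrow> real" where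
  "log_ratio p c c' t x y =
    ln (transition_prob (generator p c) t x y / transition_prob (generator p c') t x y)"

text \<open>On the diagonal both kernels tend to 1 and the log ratio tends to 0. Since the chain
  stays put with probability close to 1, the first-order term counts; it is the difference of the
  derivatives at 0 of the two logarithms, \<open>- c x\<close> and \<open>- c' x\<close>.\<close>

lemma tendsto_log_ratio_diag:
  assumes c: "\<forall>x. 0 < c x" "\<forall>x. 0 < c' x" and px: "pmf (p x) x = 0"
  shows "((\<lambda>t. log_ratio p c c' t x x / t) \<longlongrightarrow> c' x - c x) (at_right 0)"
proof -
  have D: "((\<lambda>t. ln (transition_prob (generator p c) t x x)) has_real_derivative - c x) (at 0)"
    if c: "\<forall>x. 0 < c x" for c
    using DERIV_chain2[OF DERIV_ln_divide transition_prob_has_derivative_0[OF c, where p=p and x=x and y=x]]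
    by (simp add: transition_prob_0 generator_indicator px)
  have "((\<lambda>t. ln (transition_prob (generator p c) t x x) - ln (transition_prob (generator p c') t x x))
      has_real_derivative - c x - - c' x) (at 0)"
    by (intro DERIV_diff D c)
  then have "((\<lambda>t. (ln (transition_prob (generator p c) t x x)
      - ln (transition_prob (generator p c') t x x)) / t) \<longlongrightarrow> c' x - c x) (at 0)"
    by (simp add: DERIV_def transition_prob_0)
  then have lim: "((\<lambda>t. (ln (transition_prob (generator p c) t x x)
      - ln (transition_prob (generator p c') t x x)) / t) \<longlongrightarrow> c' x - c x) (at_right 0)"
    by (auto intro: filterlim_mono[OF _ order_refl at_le])
  have pos: "\<forall>\<^sub>F t in at_right 0. transition_prob (generator p c) t x x > 0"
    if c: "\<forall>x. 0 < c x" for c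
  proof -
    have "isCont (\<lambda>t. transition_prob (generator p c) t x x) 0"
      using transition_prob_has_derivative_0[OF c] DERIV_isCont by blast
    then have "((\<lambda>t. transition_prob (generator p c) t x x) \<longlongrightarrow> 1) (at_right 0)"
      unfolding isCont_def by (auto simp: transition_prob_0 intro: filterlim_mono[OF _ order_refl at_le])
    then show ?thesis by (rule order_tendstoD) simp
  qed
  show ?thesis
    using lim
  proof (rule Lim_transform_eventually)
    show "\<forall>\<^sub>F t in at_right 0. (ln (transition_prob (generator p c) t x x)
      - ln (transition_prob (generator p c') t x x)) / t = log_ratio p c c' t x x / t"
      using pos[OF c(1)] pos[OF c(2)] by eventually_elim (simp add: log_ratio_def ln_div)
  qed
qed

text \<open>Both kernels are of exact order \<open>t ^ chain_dist p x y\<close>, with the same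
  exponent because the distance ignores the rates; this power cancels in the quotient and leaves the
  ratio of the two leading coefficients.\<close>

lemma tendsto_log_ratio:
  assumes irr: "irreducible_chain p" and c: "\<forall>x. 0 < c x" "\<forall>x. 0 < c' x"
  defines "l \<equiv> \<lambda>x y. ln (gen_coeff p c x y (chain_dist p x y) / gen_coeff p c' x y (chain_dist p x y))"
  shows "((\<lambda>t. log_ratio p c c' t x y) \<longlongrightarrow> l x y) (at_right 0)"
proof -
  let ?d = "chain_dist p x y"
  have "((\<lambda>t. ln ((transition_prob (generator p c) t x y / t ^ ?d) / (transition_prob (generator p c') t x y / t ^ ?d)))
      \<longlongrightarrow> l x y) (at_right 0)"
    unfolding l_def
    using transition_prob_leading_term_chain_dist(2)[OF irr c(1), of x y]
      transition_prob_leading_term_chain_dist(2)[OF irr c(2), of x y]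
    by (intro tendsto_ln tendsto_divide transition_prob_leading_term_chain_dist(1) irr c) auto
  then show ?thesis
    by (rule Lim_transform_eventually)
      (rule eventually_mono[OF eventually_at_right_less[of 0]], simp add: log_ratio_def)
qed

lemma chain_dist_eq_1:
  assumes "x \<noteq> y" "pmf (p x) y > 0"
  shows "chain_dist p x y = 1"
  unfolding chain_dist_def
proof (rule Least_equality)
  show "pmf (n_step p 1 x) y > 0" using assms by (simp add: n_step_def bind_return_pmf)
  fix n assume "pmf (n_step p n x) y > 0"
  then show "1 \<le> n"
    using assms by (cases n) (auto simp: n_step_def)
qed

lemma tendsto_transition_prob_div:
  assumes c: "\<forall>x. 0 < c x" and xy: "x \<noteq> y" and px: "pmf (p x) x = 0"
  shows "((\<lambda>t. transition_prob (generator p c) t x y / t) \<longlongrightarrow> c x * pmf (p x) y) (at_right 0)"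
  using transition_prob_leading_term[OF c, of 1 p x y] xy px
  by (simp add: gen_coeff_def generator_indicator)

text \<open>Three regimes meet in one formula. On the diagonal the weight tends to 1 and the log
  ratio is of order \<open>t\<close>; for a neighbour the weight is of order \<open>t\<close> and
  the log ratio converges; for any other state the weight is o(t) and the log ratio stays bounded,
  so the limit is 0.\<close>

lemma tendsto_transition_log_ratio:
  assumes irr: "irreducible_chain p" and c: "\<forall>x. 0 < c x" "\<forall>x. 0 < c' x"
    and px: "pmf (p x) x = 0"
  shows "((\<lambda>t. transition_prob (generator p c) t x y * log_ratio p c c' t x y / t) \<longlongrightarrow>
    (if x = y then c' x - c x else c x * pmf (p x) y * ln (c x / c' x))) (at_right 0)"
proof (cases "x = y")
  case True
  have "isCont (\<lambda>t. transition_prob (generator p c) t x x) 0"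
    using transition_prob_has_derivative_0[OF c(1)] DERIV_isCont by blast
  then have "((\<lambda>t. transition_prob (generator p c) t x x) \<longlongrightarrow> 1) (at_right 0)"
    unfolding isCont_def by (auto simp: transition_prob_0 intro: filterlim_mono[OF _ order_refl at_le])
  from tendsto_mult[OF this tendsto_log_ratio_diag[where p=p and x=x, OF c px]] show ?thesis
    by (simp add: True)
next
  case False
  from tendsto_mult[OF tendsto_transition_prob_div[where p=p, OF c(1) False px] tendsto_log_ratio[OF irr c, of x y]]
  have "((\<lambda>t. transition_prob (generator p c) t x y * log_ratio p c c' t x y / t) \<longlongrightarrow>
    c x * pmf (p x) y * ln (gen_coeff p c x y (chain_dist p x y) / gen_coeff p c' x y (chain_dist p x y))) (at_right 0)"
    by simp
  \<comment> \<open>For a neighbour the leading coefficients are \<open>c x * pmf (p x) y\<close>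
    and \<open>c' x * pmf (p x) y\<close>, and the common factor cancels. Otherwise the prefactor
    \<open>pmf (p x) y\<close> is 0 and the logarithm is irrelevant.\<close>
  moreover have "c x * pmf (p x) y * ln (gen_coeff p c x y (chain_dist p x y) / gen_coeff p c' x y (chain_dist p x y))
    = c x * pmf (p x) y * ln (c x / c' x)"
  proof (cases "pmf (p x) y > 0")
    case True
    then show ?thesis using False px
      by (simp add: chain_dist_eq_1 gen_coeff_def generator_indicator)
  next
    case f: False
    then have "pmf (p x) y = 0" using pmf_nonneg[of "p x" y] by linarith
    then show ?thesis by simp
  qed
  ultimately show ?thesis using False by simp
qed

section \<open>Stationary Markov processes given by their finite-dimensional distributions\<close>

lemma prod_lessThan_add:
  fixes f :: "nat \<Rightarrow> 'b::comm_monoid_mult"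
  shows "(\<Prod>i<m + n. f i) = (\<Prod>i<m. f i) * (\<Prod>i<n. f (m + i))"
  by (induction n) (simp_all add: mult_ac)

lemma all_le_Suc_shift: "(\<forall>i\<le>Suc n. Q i) \<longleftrightarrow> Q 0 \<and> (\<forall>i\<le>n. Q (Suc i))"
  by (metis Suc_le_mono le0 not0_implies_Suc)

lemma (in prob_space) prob_sum_values:
  fixes X :: "'a \<Rightarrow> 'b"
  assumes fin: "finite S" and A: "{\<omega> \<in> space M. A \<omega>} \<in> events"
    and X: "\<And>z. z \<in> S \<Longrightarrow> {\<omega> \<in> space M. X \<omega> = z} \<in> events"
  shows "prob {\<omega> \<in> space M. X \<omega> \<in> S \<and> A \<omega>} = (\<Sum>z\<in>S. prob {\<omega> \<in> space M. X \<omega> = z \<and> A \<omega>})"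
proof -
  have "prob (\<Union>z\<in>S. {\<omega> \<in> space M. X \<omega> = z \<and> A \<omega>}) = (\<Sum>z\<in>S. prob {\<omega> \<in> space M. X \<omega> = z \<and> A \<omega>})"
    using A X by (intro finite_measure_finite_Union fin) (auto simp: disjoint_family_on_def)
  moreover have "(\<Union>z\<in>S. {\<omega> \<in> space M. X \<omega> = z \<and> A \<omega>}) = {\<omega> \<in> space M. X \<omega> \<in> S \<and> A \<omega>}"
    by auto
  ultimately show ?thesis by simp
qed

text \<open>Only the finite-dimensional distributions are kept and the kernel \<open>R\<close> is
  abstract. Since \<open>init_pos\<close> permits division by the initial weights, nonnegativity,
  row sums and the Chapman-Kolmogorov equation for \<open>R\<close> are read off from probabilities
  instead of being derived from the exponential series.\<close>

locale stationary_markov = prob_space P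
  for P :: "(real \<Rightarrow> 'a::finite) measure" +
  fixes \<mu> :: "'a pmf" and R :: "real \<Rightarrow> 'a \<Rightarrow> 'a \<Rightarrow> real"
  assumes eval_measurable: "0 \<le> t \<Longrightarrow> (\<lambda>\<omega>. \<omega> t) \<in> measurable P (count_space UNIV)"
    and fdd0: "s 0 = 0 \<Longrightarrow> (\<And>i. i < n \<Longrightarrow> s i \<le> s (Suc i)) \<Longrightarrow>
      prob {\<omega> \<in> space P. \<forall>i\<le>n. \<omega> (s i) = x i} =
        pmf \<mu> (x 0) * (\<Prod>i<n. R (s (Suc i) - s i) (x i) (x (Suc i)))"
    and stat: "0 \<le> t \<Longrightarrow> (\<Sum>x\<in>UNIV. pmf \<mu> x * R t x y) = pmf \<mu> y"
    and init_pos: "pmf \<mu> z > 0"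
begin

lemma eval_event: "0 \<le> t \<Longrightarrow> {\<omega> \<in> space P. \<omega> t = z} \<in> events"
  using measurable_sets[OF eval_measurable, of t "{z}"] by (simp add: vimage_def Int_def conj_commute)

lemma cylinder_event:
  "finite I \<Longrightarrow> (\<And>i. i \<in> I \<Longrightarrow> 0 \<le> s i) \<Longrightarrow> {\<omega> \<in> space P. \<forall>i\<in>I. \<omega> (s i) = x i} \<in> events"
  by (intro sets.sets_Collect_finite_All eval_event) auto

lemma cylinder_event_atMost:
  assumes "\<And>i. i \<le> (n::nat) \<Longrightarrow> 0 \<le> s i"
  shows "{\<omega> \<in> space P. \<forall>i\<le>n. \<omega> (s i) = x i} \<in> events"
proof -
  have "{\<omega> \<in> space P. \<forall>i\<in>{..n}. \<omega> (s i) = x i} \<in> events"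
    using assms by (intro cylinder_event) auto
  then show ?thesis by (simp only: Ball_def atMost_iff)
qed

text \<open>The restriction to a first time equal to 0 is removed by prepending time 0, summing over
  the state there and absorbing the extra transition by stationarity.\<close>

lemma fdd:
  assumes s0: "0 \<le> s 0" and mono: "\<And>i. i < n \<Longrightarrow> s i \<le> s (Suc i)"
  shows "prob {\<omega> \<in> space P. \<forall>i\<le>n. \<omega> (s i) = x i} =
        pmf \<mu> (x 0) * (\<Prod>i<n. R (s (Suc i) - s i) (x i) (x (Suc i)))"
proof -
  have nonneg: "0 \<le> s i" if "i \<le> n" for i
    using that by (induction i) (use s0 in simp, metis Suc_le_eq mono less_imp_le order_trans)
  have "prob {\<omega> \<in> space P. \<forall>i\<le>n. \<omega> (s i) = x i} =
     (\<Sum>z\<in>UNIV. prob {\<omega> \<in> space P. \<omega> 0 = z \<and> (\<forall>i\<le>n. \<omega> (s i) = x i)})"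
    using prob_sum_values[of UNIV "\<lambda>\<omega>. \<forall>i\<le>n. \<omega> (s i) = x i" "\<lambda>\<omega>. \<omega> 0"]
    by (simp add: cylinder_event_atMost nonneg eval_event)
  also have "\<dots> = (\<Sum>z\<in>UNIV. pmf \<mu> z * R (s 0) z (x 0) * (\<Prod>i<n. R (s (Suc i) - s i) (x i) (x (Suc i))))"
  proof (rule sum.cong[OF refl])
    fix z
    have "prob {\<omega> \<in> space P. \<forall>i\<le>Suc n. \<omega> (case_nat 0 s i) = case_nat z x i} =
        pmf \<mu> z * (\<Prod>i<Suc n. R (case_nat 0 s (Suc i) - case_nat 0 s i) (case_nat z x i) (case_nat z x (Suc i)))"
      by (subst fdd0) (auto split: nat.split simp: s0 mono)
    also have "\<dots> = pmf \<mu> z * R (s 0) z (x 0) * (\<Prod>i<n. R (s (Suc i) - s i) (x i) (x (Suc i)))"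
      unfolding prod.lessThan_Suc_shift by (simp add: mult_ac)
    also have "{\<omega> \<in> space P. \<forall>i\<le>Suc n. \<omega> (case_nat 0 s i) = case_nat z x i} =
        {\<omega> \<in> space P. \<omega> 0 = z \<and> (\<forall>i\<le>n. \<omega> (s i) = x i)}"
      by (simp add: all_le_Suc_shift)
    finally show "prob {\<omega> \<in> space P. \<omega> 0 = z \<and> (\<forall>i\<le>n. \<omega> (s i) = x i)} =
      pmf \<mu> z * R (s 0) z (x 0) * (\<Prod>i<n. R (s (Suc i) - s i) (x i) (x (Suc i)))" .
  qed
  also have "\<dots> = pmf \<mu> (x 0) * (\<Prod>i<n. R (s (Suc i) - s i) (x i) (x (Suc i)))"
    by (simp add: stat s0 flip: sum_distrib_right)
  finally show ?thesis .
qed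

lemma prob_pair:
  assumes "0 \<le> u" "u \<le> t"
  shows "prob {\<omega> \<in> space P. \<omega> u = x \<and> \<omega> t = y} = pmf \<mu> x * R (t - u) x y"
proof -
  have "{\<omega> \<in> space P. \<forall>i\<le>1. \<omega> ([u, t] ! i) = [x, y] ! i} = {\<omega> \<in> space P. \<omega> u = x \<and> \<omega> t = y}"
    by (auto simp: le_Suc_eq)
  then show ?thesis
    using fdd[of "\<lambda>i. [u, t] ! i" 1 "\<lambda>i. [x, y] ! i"] assms by simp
qed

lemma R_nonneg: "0 \<le> t \<Longrightarrow> 0 \<le> R t x y"
  using prob_pair[of 0 t x y] init_pos[of x]
    measure_nonneg[of P "{\<omega> \<in> space P. \<omega> 0 = x \<and> \<omega> t = y}"]
  by (simp add: zero_le_mult_iff)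

lemma R_row_sum:
  assumes "0 \<le> t"
  shows "(\<Sum>y\<in>UNIV. R t x y) = 1"
proof -
  have "prob {\<omega> \<in> space P. \<omega> 0 = x} = pmf \<mu> x"
    using fdd[of "\<lambda>_. 0" 0 "\<lambda>_. x"] by simp
  moreover have "prob {\<omega> \<in> space P. \<omega> 0 = x} = (\<Sum>y\<in>UNIV. prob {\<omega> \<in> space P. \<omega> t = y \<and> \<omega> 0 = x})"
    using prob_sum_values[of UNIV "\<lambda>\<omega>. \<omega> 0 = x" "\<lambda>\<omega>. \<omega> t"] assms
    by (simp add: eval_event)
  moreover have "prob {\<omega> \<in> space P. \<omega> t = y \<and> \<omega> 0 = x} = pmf \<mu> x * R t x y" for y
    using prob_pair[of 0 t x y] assms by (simp add: conj_commute)
  ultimately show ?thesis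
    using init_pos[of x] by (simp flip: sum_distrib_left)
qed

lemma R_le_1: "0 \<le> t \<Longrightarrow> R t x y \<le> 1"
  using member_le_sum[of y UNIV "R t x"] R_row_sum[of t x] R_nonneg[of t x] by simp

lemma chapman_kolmogorov:
  assumes "0 \<le> u" "0 \<le> t"
  shows "R (u + t) x z = (\<Sum>y\<in>UNIV. R u x y * R t y z)"
proof -
  have "prob {\<omega> \<in> space P. \<omega> 0 = x \<and> \<omega> (u + t) = z} =
      (\<Sum>y\<in>UNIV. prob {\<omega> \<in> space P. \<omega> u = y \<and> \<omega> 0 = x \<and> \<omega> (u + t) = z})"
  proof -
    have "{\<omega> \<in> space P. \<omega> 0 = x \<and> \<omega> (u + t) = z} \<in> events"
      using assms by (intro sets.sets_Collect_conj eval_event) auto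
    then show ?thesis
      using prob_sum_values[of UNIV "\<lambda>\<omega>. \<omega> 0 = x \<and> \<omega> (u + t) = z" "\<lambda>\<omega>. \<omega> u"] assms
      by (simp add: eval_event)
  qed
  moreover have "prob {\<omega> \<in> space P. \<omega> u = y \<and> \<omega> 0 = x \<and> \<omega> (u + t) = z} = pmf \<mu> x * (R u x y * R t y z)" for y
  proof -
    have "{\<omega> \<in> space P. \<forall>i\<le>2. \<omega> ([0, u, u + t] ! i) = [x, y, z] ! i} =
        {\<omega> \<in> space P. \<omega> u = y \<and> \<omega> 0 = x \<and> \<omega> (u + t) = z}"
      by (auto simp: le_Suc_eq numeral_2_eq_2)
    moreover have "prob {\<omega> \<in> space P. \<forall>i\<le>2. \<omega> ([0, u, u + t] ! i) = [x, y, z] ! i} = pmf \<mu> x * (R u x y * R t y z)"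
      using assms by (subst fdd) (auto simp: numeral_2_eq_2 less_Suc_eq)
    ultimately show ?thesis by simp
  qed
  ultimately show ?thesis
    using prob_pair[of 0 "u + t" x z] assms init_pos[of x] by (simp flip: sum_distrib_left)
qed

text \<open>By Chapman-Kolmogorov the entries of \<open>R t\<close> are averages of entries of
  \<open>R u\<close> over the state at time \<open>t - u\<close>.\<close>

lemma R_lower_bound_mono:
  assumes "0 \<le> u" "u \<le> t" "\<And>x y. \<kappa> \<le> R u x y"
  shows "\<kappa> \<le> R t x y"
proof -
  have "R t x y = (\<Sum>z\<in>UNIV. R (t - u) x z * R u z y)"
    using chapman_kolmogorov[of "t - u" u] assms by simp
  moreover have "(\<Sum>z\<in>UNIV. R (t - u) x z * \<kappa>) \<le> (\<Sum>z\<in>UNIV. R (t - u) x z * R u z y)"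
    using assms by (intro sum_mono mult_left_mono R_nonneg) auto
  ultimately show ?thesis
    using R_row_sum[of "t - u" x] assms by (simp flip: sum_distrib_right)
qed

text \<open>One constant serves all times beyond \<open>u\<close>, so it can stay fixed while the
  grid is refined and the exact duration of the gaps varies.\<close>

lemma positive_lower_bound:
  assumes "0 < u" "\<And>x y. R u x y > 0"
  obtains \<kappa> where "0 < \<kappa>" "\<kappa> \<le> 1" "\<And>t x y. u \<le> t \<Longrightarrow> \<kappa> \<le> R t x y"
proof
  define \<kappa> where "\<kappa> = Min (range (\<lambda>(x, y). R u x y))"
  show "0 < \<kappa>" unfolding \<kappa>_def using assms by (subst Min_gr_iff) auto
  have \<kappa>: "\<kappa> \<le> R u x y" for x y
    unfolding \<kappa>_def by (rule Min_le) (auto intro!: image_eqI[of _ _ "(x, y)"])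
  show "\<kappa> \<le> R t x y" if "u \<le> t" for t x y
    using R_lower_bound_mono[OF _ that \<kappa>] assms by simp
  show "\<kappa> \<le> 1" using \<kappa> R_le_1 assms(1) by (meson less_imp_le order_trans)
qed

section \<open>Words, windows and the probability of a match\<close>

definition word_weight :: "real \<Rightarrow> nat \<Rightarrow> (nat \<Rightarrow> 'a) \<Rightarrow> real" where
  "word_weight \<delta> n a = pmf \<mu> (a 1) * (\<Prod>i<n - 1. R \<delta> (a (Suc i)) (a (Suc (Suc i))))"

text \<open>Letters sit at the indices 1 to \<open>n\<close>, as in \<open>waiting_time\<close>, so
  a match at \<open>k\<close> occupies the grid points from \<open>k + 1\<close> to
  \<open>k + n\<close> and involves \<open>n - 1\<close> transitions.\<close>

definition match :: "real \<Rightarrow> nat \<Rightarrow> (nat \<Rightarrow> 'a) \<Rightarrow> nat \<Rightarrow> (real \<Rightarrow> 'a) \<Rightarrow> bool" where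
  "match \<delta> n a k \<omega> \<longleftrightarrow> (\<forall>i\<in>{1..n}. \<omega> (real (k + i) * \<delta>) = a i)"

lemma match_event: "0 \<le> \<delta> \<Longrightarrow> {\<omega> \<in> space P. match \<delta> n a k \<omega>} \<in> events"
  unfolding match_def by (rule cylinder_event) auto

lemma prob_match:
  assumes "0 \<le> \<delta>" "1 \<le> n"
  shows "prob {\<omega> \<in> space P. match \<delta> n a k \<omega>} = word_weight \<delta> n a"
proof -
  have eq: "{\<omega> \<in> space P. match \<delta> n a k \<omega>} =
      {\<omega> \<in> space P. \<forall>i\<le>n - 1. \<omega> (real (k + Suc i) * \<delta>) = a (Suc i)}"
  proof -
    have "{1..n} = Suc ` {..n - 1}" using assms by (simp add: image_Suc_atMost)
    then show ?thesis unfolding match_def by (auto simp del: of_nat_add of_nat_Suc)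
  qed
  moreover have "real (k + Suc (Suc i)) * \<delta> - real (k + Suc i) * \<delta> = \<delta>" for i
    by (simp add: algebra_simps)
  ultimately show ?thesis
    using assms unfolding eq by (subst fdd) (auto simp: word_weight_def intro!: mult_right_mono)
qed

lemma word_weight_nonneg: "0 \<le> \<delta> \<Longrightarrow> 0 \<le> word_weight \<delta> n a"
  unfolding word_weight_def by (intro mult_nonneg_nonneg prod_nonneg) (auto simp: R_nonneg)

lemma word_weight_le_1: "0 \<le> \<delta> \<Longrightarrow> 1 \<le> n \<Longrightarrow> word_weight \<delta> n a \<le> 1"
  using prob_match[of \<delta> n a 0] prob_le_1 by metis

lemma prob_early_match_le:
  assumes "0 \<le> \<delta>" "1 \<le> n"
  shows "prob {\<omega> \<in> space P. \<exists>k\<in>{1..K}. match \<delta> n a k \<omega>} \<le> real K * word_weight \<delta> n a"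
proof -
  have "{\<omega> \<in> space P. \<exists>k\<in>{1..K}. match \<delta> n a k \<omega>} = (\<Union>k\<in>{1..K}. {\<omega> \<in> space P. match \<delta> n a k \<omega>})"
    by auto
  also have "prob \<dots> \<le> (\<Sum>k\<in>{1..K}. prob {\<omega> \<in> space P. match \<delta> n a k \<omega>})"
    using match_event[OF assms(1)] by (intro finite_measure_subadditive_finite) auto
  finally show ?thesis using assms by (simp add: prob_match)
qed

text \<open>Exact factorization by the Markov property. A window placed at \<open>T + g\<close> has
  its first letter at the grid point \<open>T + g + 1\<close>, which is why the gap kernel has
  duration \<open>real (Suc g) * \<delta>\<close>.\<close>

lemma prob_history_match:
  assumes "0 \<le> \<delta>" "1 \<le> n"
  shows "prob {\<omega> \<in> space P. (\<forall>i\<le>T. \<omega> (real i * \<delta>) = b i) \<and> match \<delta> n a (T + g) \<omega>} =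
    prob {\<omega> \<in> space P. \<forall>i\<le>T. \<omega> (real i * \<delta>) = b i} *
    (R (real (Suc g) * \<delta>) (b T) (a 1) * (\<Prod>i<n - 1. R \<delta> (a (Suc i)) (a (Suc (Suc i)))))"
proof -
  \<comment> \<open>The enumeration of observed times runs through 0 to \<open>T\<close> and then
    skips \<open>g\<close> grid points, so that history and window form one finite-dimensional
    cylinder.\<close>
  define s where "s = (\<lambda>i. real (if i \<le> T then i else i + g) * \<delta>)"
  define x where "x = (\<lambda>i. if i \<le> T then b i else a (i - T))"
  obtain m where n: "n = Suc m" using assms by (cases n) auto
  have "(\<forall>i\<le>T + n. \<omega> (s i) = x i) \<longleftrightarrow> (\<forall>i\<le>T. \<omega> (real i * \<delta>) = b i) \<and> match \<delta> n a (T + g) \<omega>" for \<omega>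
  proof safe
    assume *: "\<forall>i\<le>T + n. \<omega> (s i) = x i"
    show "\<omega> (real i * \<delta>) = b i" if "i \<le> T" for i using *[rule_format, of i] that by (simp add: s_def x_def)
    show "match \<delta> n a (T + g) \<omega>" unfolding match_def
    proof
      fix i assume "i \<in> {1..n}"
      then show "\<omega> (real (T + g + i) * \<delta>) = a i" using *[rule_format, of "T + i"]
        by (simp add: s_def x_def add_ac)
    qed
  next
    fix i assume *: "\<forall>i\<le>T. \<omega> (real i * \<delta>) = b i" "match \<delta> n a (T + g) \<omega>" "i \<le> T + n"
    show "\<omega> (s i) = x i"
    proof (cases "i \<le> T")
      case False
      then have "i - T \<in> {1..n}" "T + g + (i - T) = i + g" using * by auto
      then show ?thesis using *(2) False unfolding match_def s_def x_def by metis
    qed (use * in \<open>simp add: s_def x_def\<close>)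
  qed
  then have "prob {\<omega> \<in> space P. (\<forall>i\<le>T. \<omega> (real i * \<delta>) = b i) \<and> match \<delta> n a (T + g) \<omega>} =
    prob {\<omega> \<in> space P. \<forall>i\<le>T + n. \<omega> (s i) = x i}" by simp
  also have "\<dots> = pmf \<mu> (x 0) * (\<Prod>i<T + n. R (s (Suc i) - s i) (x i) (x (Suc i)))"
    using assms by (intro fdd) (auto simp: s_def intro!: mult_right_mono)
  also have "\<dots> = (pmf \<mu> (b 0) * (\<Prod>i<T. R (s (Suc i) - s i) (x i) (x (Suc i)))) *
      (R (s (Suc T) - s T) (x T) (x (Suc T)) *
       (\<Prod>i<m. R (s (Suc (T + Suc i)) - s (T + Suc i)) (x (T + Suc i)) (x (Suc (T + Suc i)))))"
    unfolding prod_lessThan_add n prod.lessThan_Suc_shift by (simp add: x_def mult_ac)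
  also have "(\<Prod>i<T. R (s (Suc i) - s i) (x i) (x (Suc i))) = (\<Prod>i<T. R (real (Suc i) * \<delta> - real i * \<delta>) (b i) (b (Suc i)))"
    by (intro prod.cong refl) (auto simp: s_def x_def)
  also have "pmf \<mu> (b 0) * \<dots> = prob {\<omega> \<in> space P. \<forall>i\<le>T. \<omega> (real i * \<delta>) = b i}"
    using assms by (subst fdd) (auto intro!: mult_right_mono)
  also have "s (Suc T) - s T = real (Suc g) * \<delta>" by (simp add: s_def algebra_simps)
  also have "(\<Prod>i<m. R (s (Suc (T + Suc i)) - s (T + Suc i)) (x (T + Suc i)) (x (Suc (T + Suc i))))
      = (\<Prod>i<m. R \<delta> (a (Suc i)) (a (Suc (Suc i))))"
    by (intro prod.cong refl) (auto simp: s_def x_def algebra_simps Suc_diff_le)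
  finally show ?thesis by (simp add: x_def n)
qed

text \<open>Whatever the past up to \<open>T\<close>, a window after the gap matches with
  conditional probability at least \<kappa> times the stationary one: sum over the histories in
  \<open>S\<close>, bound the gap kernel below by \<kappa>, and use that the factor
  \<open>pmf \<mu> (a 1)\<close> in the word weight is at most 1. Histories are restricted
  functions, so that there are finitely many of them.\<close>

lemma prob_restrict_match_ge:
  assumes \<delta>: "0 \<le> \<delta>" "1 \<le> n" and \<kappa>: "0 \<le> \<kappa>" "\<And>x y. \<kappa> \<le> R (real (Suc g) * \<delta>) x y"
    and S: "S \<subseteq> {..T} \<rightarrow>\<^sub>E UNIV"
  defines "h \<equiv> \<lambda>\<omega>. \<lambda>i\<in>{..T}. \<omega> (real i * \<delta>)"
  shows "\<kappa> * word_weight \<delta> n a * prob {\<omega> \<in> space P. h \<omega> \<in> S}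
    \<le> prob {\<omega> \<in> space P. h \<omega> \<in> S \<and> match \<delta> n a (T + g) \<omega>}"
proof -
  have fin: "finite S" using S by (rule finite_subset) (simp add: finite_PiE)
  have eq: "h \<omega> = b \<longleftrightarrow> (\<forall>i\<le>T. \<omega> (real i * \<delta>) = b i)" if "b \<in> S" for b \<omega>
  proof -
    have "b i = undefined" if "\<not> i \<le> T" for i
      using that \<open>b \<in> S\<close> S by (auto simp: PiE_def extensional_def)
    then show ?thesis by (auto simp: h_def fun_eq_iff)
  qed
  have ev: "{\<omega> \<in> space P. h \<omega> = b} \<in> events" if "b \<in> S" for b
    using that \<delta> by (simp add: eq cylinder_event_atMost)
  have "\<kappa> * word_weight \<delta> n a * prob {\<omega> \<in> space P. h \<omega> \<in> S} =
      (\<Sum>b\<in>S. \<kappa> * word_weight \<delta> n a * prob {\<omega> \<in> space P. h \<omega> = b})"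
    using prob_sum_values[OF fin, of "\<lambda>_. True" h] ev by (simp add: sum_distrib_left)
  also have "\<dots> \<le> (\<Sum>b\<in>S. prob {\<omega> \<in> space P. h \<omega> = b \<and> match \<delta> n a (T + g) \<omega>})"
  proof (rule sum_mono)
    fix b assume b: "b \<in> S"
    have "\<kappa> * word_weight \<delta> n a \<le>
        R (real (Suc g) * \<delta>) (b T) (a 1) * (\<Prod>i<n - 1. R \<delta> (a (Suc i)) (a (Suc (Suc i))))"
    proof (rule mult_mono)
      have "pmf \<mu> (a 1) * (\<Prod>i<n - 1. R \<delta> (a (Suc i)) (a (Suc (Suc i)))) \<le>
          1 * (\<Prod>i<n - 1. R \<delta> (a (Suc i)) (a (Suc (Suc i))))"
        using \<delta> by (intro mult_right_mono prod_nonneg ballI R_nonneg pmf_le_1)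
      then show "word_weight \<delta> n a \<le> (\<Prod>i<n - 1. R \<delta> (a (Suc i)) (a (Suc (Suc i))))"
        by (simp add: word_weight_def)
    qed (use \<delta> \<kappa> in \<open>auto intro!: word_weight_nonneg R_nonneg\<close>)
    then have "prob {\<omega> \<in> space P. h \<omega> = b} * (\<kappa> * word_weight \<delta> n a) \<le>
      prob {\<omega> \<in> space P. h \<omega> = b} * (R (real (Suc g) * \<delta>) (b T) (a 1) * (\<Prod>i<n - 1. R \<delta> (a (Suc i)) (a (Suc (Suc i)))))"
      by (rule mult_left_mono) simp
    then show "\<kappa> * word_weight \<delta> n a * prob {\<omega> \<in> space P. h \<omega> = b} \<le> prob {\<omega> \<in> space P. h \<omega> = b \<and> match \<delta> n a (T + g) \<omega>}"
      using prob_history_match[OF \<delta>, of T b a g] b by (simp add: eq mult_ac)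
  qed
  also have "\<dots> = prob {\<omega> \<in> space P. h \<omega> \<in> S \<and> match \<delta> n a (T + g) \<omega>}"
    using prob_sum_values[OF fin match_event[OF \<delta>(1), of n a "T + g"] ev] by simp
  finally show ?thesis .
qed

text \<open>Window number \<open>l\<close> ends at the grid point \<open>Suc l * (n + g)\<close>.
  The first \<open>m\<close> windows are therefore determined by the history up to
  \<open>m * (n + g)\<close>, and the next window fails with conditional probability at most
  \<open>1 - \<kappa> * word_weight \<delta> n a\<close>.\<close>

lemma prob_no_match_windows_le:
  assumes \<delta>: "0 \<le> \<delta>" "1 \<le> n" and \<kappa>: "0 \<le> \<kappa>" "\<And>x y. \<kappa> \<le> R (real (Suc g) * \<delta>) x y"
  shows "prob {\<omega> \<in> space P. \<forall>l<m. \<not> match \<delta> n a (l * (n + g) + g) \<omega>} \<le> (1 - \<kappa> * word_weight \<delta> n a) ^ m"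
proof (induction m)
  case 0
  then show ?case by (simp add: prob_space)
next
  case (Suc m)
  let ?w = "word_weight \<delta> n a"
  define T where "T = m * (n + g)"
  define h where "h = (\<lambda>\<omega>::real \<Rightarrow> 'a. \<lambda>i\<in>{..T}. \<omega> (real i * \<delta>))"
  \<comment> \<open>The event that the first \<open>m\<close> windows all fail, expressed as a set
    of histories.\<close>
  define S where "S = {b \<in> {..T} \<rightarrow>\<^sub>E (UNIV::'a set). \<forall>l<m. \<not> (\<forall>i\<in>{1..n}. b (l * (n + g) + g + i) = a i)}"
  have hS: "h \<omega> \<in> S \<longleftrightarrow> (\<forall>l<m. \<not> match \<delta> n a (l * (n + g) + g) \<omega>)" for \<omega>
  proof -
    have "l * (n + g) + g + i \<le> T" if "l < m" "i \<in> {1..n}" for l i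
    proof -
      have "l * (n + g) + g + i \<le> Suc l * (n + g)" using that by simp
      also have "\<dots> \<le> T" unfolding T_def using that by (intro mult_right_mono) auto
      finally show ?thesis .
    qed
    then have "h \<omega> (l * (n + g) + g + i) = \<omega> (real (l * (n + g) + g + i) * \<delta>)" if "l < m" "i \<in> {1..n}" for l i
      using that by (simp add: h_def)
    then have "(\<forall>i\<in>{1..n}. h \<omega> (l * (n + g) + g + i) = a i) \<longleftrightarrow> match \<delta> n a (l * (n + g) + g) \<omega>" if "l < m" for l
      using that unfolding match_def by (intro ball_cong refl) simp
    moreover have "h \<omega> \<in> {..T} \<rightarrow>\<^sub>E UNIV" by (auto simp: h_def)
    ultimately show ?thesis unfolding S_def mem_Collect_eq by blast
  qed
  have ev: "{\<omega> \<in> space P. h \<omega> \<in> S} \<in> events"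
  proof -
    have "{\<omega> \<in> space P. \<forall>l\<in>{..<m}. \<not> match \<delta> n a (l * (n + g) + g) \<omega>} \<in> events"
      by (rule sets.sets_Collect_finite_All[OF sets.sets_Collect_neg[OF match_event[OF \<delta>(1)]]]) simp
    then show ?thesis by (simp only: hS Ball_def lessThan_iff)
  qed
  have "?w \<le> 1" "0 \<le> ?w" using \<delta> by (auto intro: word_weight_le_1 word_weight_nonneg)
  moreover have "\<kappa> \<le> 1" using \<kappa> R_le_1[of "real (Suc g) * \<delta>"] \<delta> by (meson mult_nonneg_nonneg of_nat_0_le_iff order_trans)
  ultimately have w: "0 \<le> 1 - \<kappa> * ?w" using \<kappa> by (simp add: mult_le_one)
  have "{\<omega> \<in> space P. \<forall>l<Suc m. \<not> match \<delta> n a (l * (n + g) + g) \<omega>} =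
      {\<omega> \<in> space P. h \<omega> \<in> S} - {\<omega> \<in> space P. h \<omega> \<in> S \<and> match \<delta> n a (T + g) \<omega>}"
    by (auto simp: hS less_Suc_eq T_def)
  then have "prob {\<omega> \<in> space P. \<forall>l<Suc m. \<not> match \<delta> n a (l * (n + g) + g) \<omega>} =
      prob {\<omega> \<in> space P. h \<omega> \<in> S} - prob {\<omega> \<in> space P. h \<omega> \<in> S \<and> match \<delta> n a (T + g) \<omega>}"
    using ev match_event[OF \<delta>(1), of n a "T + g"]
    by (simp only:) (intro finite_measure_Diff, auto intro: sets.sets_Collect_conj)
  also have "\<dots> \<le> prob {\<omega> \<in> space P. h \<omega> \<in> S} - \<kappa> * ?w * prob {\<omega> \<in> space P. h \<omega> \<in> S}"
    using prob_restrict_match_ge[OF \<delta> \<kappa>, of S T a] by (simp add: S_def h_def)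
  also have "\<dots> = (1 - \<kappa> * ?w) * prob {\<omega> \<in> space P. h \<omega> \<in> S}" by (simp add: algebra_simps)
  also have "\<dots> \<le> (1 - \<kappa> * ?w) * (1 - \<kappa> * ?w) ^ m"
    using Suc w unfolding hS by (intro mult_left_mono) auto
  finally show ?case by simp
qed

end

section \<open>Waiting times\<close>

text \<open>A finite value excludes the empty set of candidates, and in a well-order the infimum of
  a nonempty set is attained.\<close>

lemma waiting_time_eq_enatD:
  assumes "waiting_time \<delta> n x y = enat k"
  shows "1 \<le> k" "i \<in> {1..n} \<Longrightarrow> x (real i * \<delta>) = y (real (k + i) * \<delta>)"
proof -
  let ?S = "{k. 1 \<le> k \<and> (\<forall>i\<in>{1..n}. x (real i * \<delta>) = y (real (k + i) * \<delta>))}"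
  have "enat ` ?S \<noteq> {}"
    using assms unfolding waiting_time_def by (metis Inf_empty enat.distinct(2) top_enat_def)
  then have "waiting_time \<delta> n x y \<in> enat ` ?S"
    unfolding waiting_time_def by (meson wellorder_InfI ex_in_conv)
  then have k: "k \<in> ?S" using assms by auto
  show "1 \<le> k" using k by simp
  show "x (real i * \<delta>) = y (real (k + i) * \<delta>)" if "i \<in> {1..n}" using k that by blast
qed

lemma waiting_time_le:
  assumes "1 \<le> k" "\<And>i. i \<in> {1..n} \<Longrightarrow> x (real i * \<delta>) = y (real (k + i) * \<delta>)"
  shows "waiting_time \<delta> n x y \<le> enat k"
  unfolding waiting_time_def using assms by (intro Inf_lower) auto

context stationary_markov
begin

text \<open>The exceptional event depends on the word \<open>a\<close> alone and not on the path
  \<open>x\<close> that spells it, so it can later be placed over the whole fibre of paths with that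
  word. It combines a match that comes too early, excluded by the union bound, and a failure of all
  separated windows.\<close>

lemma waiting_time_deviation_event:
  assumes \<delta>: "0 \<le> \<delta>" "1 \<le> n" and g: "1 \<le> g"
    and \<kappa>: "0 \<le> \<kappa>" "\<And>x y. \<kappa> \<le> R (real (Suc g) * \<delta>) x y"
    and w: "0 < word_weight \<delta> n a"
  shows "\<exists>E\<in>events. prob E \<le> exp (- r) + exp (- \<kappa> * (exp r / real (n + g) - 1)) \<and>
    (\<forall>x \<omega>. (\<forall>i\<in>{1..n}. x (real i * \<delta>) = a i) \<longrightarrow> \<omega> \<in> space P - E \<longrightarrow>
      waiting_time \<delta> n x \<omega> \<noteq> \<infinity> \<and>
      \<bar>ln (real (the_enat (waiting_time \<delta> n x \<omega>))) + ln (word_weight \<delta> n a)\<bar> \<le> r \<and>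
      0 < the_enat (waiting_time \<delta> n x \<omega>))"
proof -
  let ?w = "word_weight \<delta> n a"
  \<comment> \<open>\<open>K\<close> is the number of early positions whose expected number of
    matches is at most \<open>exp (- r)\<close>; \<open>m\<close> is the number of windows with
    their gaps that fit below \<open>exp r\<close> divided by the weight.\<close>
  define K where "K = nat \<lfloor>exp (- r) / ?w\<rfloor>"
  define m where "m = nat \<lfloor>exp r / (?w * real (n + g))\<rfloor>"
  define E1 where "E1 = {\<omega> \<in> space P. \<exists>k\<in>{1..K}. match \<delta> n a k \<omega>}"
  define E2 where "E2 = {\<omega> \<in> space P. \<forall>l<m. \<not> match \<delta> n a (l * (n + g) + g) \<omega>}"
  have ng: "0 < real (n + g)" using g by simp
  have K: "real K \<le> exp (- r) / ?w" "exp (- r) / ?w < real K + 1"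
    using w unfolding K_def by (simp_all add: of_nat_floor)
  have m: "real m \<le> exp r / (?w * real (n + g))" "exp r / (?w * real (n + g)) < real m + 1"
    using w ng unfolding m_def by (simp_all add: of_nat_floor)
  have ev: "E1 \<in> events" "E2 \<in> events"
  proof -
    have "E1 = (\<Union>k\<in>{1..K}. {\<omega> \<in> space P. match \<delta> n a k \<omega>})" by (auto simp: E1_def)
    then show "E1 \<in> events" using match_event[OF \<delta>(1)] by auto
    have "{\<omega> \<in> space P. \<forall>l\<in>{..<m}. \<not> match \<delta> n a (l * (n + g) + g) \<omega>} \<in> events"
      by (rule sets.sets_Collect_finite_All[OF sets.sets_Collect_neg[OF match_event[OF \<delta>(1)]]]) simp
    then show "E2 \<in> events" by (simp only: E2_def Ball_def lessThan_iff)
  qed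
  have "prob E1 \<le> real K * ?w" unfolding E1_def by (rule prob_early_match_le[OF \<delta>])
  also have "\<dots> \<le> exp (- r)" using K w by (simp add: field_simps)
  finally have 1: "prob E1 \<le> exp (- r)" .
  have "prob E2 \<le> (1 - \<kappa> * ?w) ^ m" unfolding E2_def by (rule prob_no_match_windows_le[OF \<delta> \<kappa>])
  also have "\<dots> \<le> exp (- (\<kappa> * ?w)) ^ m"
  proof (rule power_mono)
    show "1 - \<kappa> * ?w \<le> exp (- (\<kappa> * ?w))" using exp_ge_add_one_self[of "- (\<kappa> * ?w)"] by simp
    have "\<kappa> \<le> 1" using \<kappa> R_le_1[of "real (Suc g) * \<delta>"] \<delta> by (meson mult_nonneg_nonneg of_nat_0_le_iff order_trans)
    then show "0 \<le> 1 - \<kappa> * ?w" using \<kappa> w word_weight_le_1[OF \<delta>, of a] by (simp add: mult_le_one)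
  qed
  also have "\<dots> = exp (- \<kappa> * (?w * real m))" by (simp add: exp_of_nat_mult[symmetric] mult_ac)
  also have "\<dots> \<le> exp (- \<kappa> * (exp r / real (n + g) - 1))"
  proof -
    \<comment> \<open>Rounding \<open>m\<close> down loses less than one window, hence at most 1
      after multiplication by the weight; this is the \<open>- 1\<close> in the bound.\<close>
    have "exp r / real (n + g) = ?w * (exp r / (?w * real (n + g)))" using w by simp
    also have "\<dots> \<le> ?w * (real m + 1)" using m w by (intro mult_left_mono) auto
    also have "\<dots> \<le> ?w * real m + 1" using word_weight_le_1[OF \<delta>, of a] by (simp add: algebra_simps)
    finally show ?thesis using \<kappa> by (simp add: mult_left_mono)
  qed
  finally have 2: "prob E2 \<le> exp (- \<kappa> * (exp r / real (n + g) - 1))" .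
  have "prob (E1 \<union> E2) \<le> exp (- r) + exp (- \<kappa> * (exp r / real (n + g) - 1))"
    using measure_Un_le[OF ev] 1 2 by simp
  moreover have "waiting_time \<delta> n x \<omega> \<noteq> \<infinity> \<and>
      \<bar>ln (real (the_enat (waiting_time \<delta> n x \<omega>))) + ln ?w\<bar> \<le> r \<and>
      0 < the_enat (waiting_time \<delta> n x \<omega>)"
    if x: "\<And>i. i \<in> {1..n} \<Longrightarrow> x (real i * \<delta>) = a i" and \<omega>: "\<omega> \<in> space P" "\<omega> \<notin> E1 \<union> E2" for x \<omega>
  proof -
    obtain l where l: "l < m" "match \<delta> n a (l * (n + g) + g) \<omega>"
      using \<omega> by (auto simp: E2_def)
    \<comment> \<open>Waiting times start at 1; \<open>1 \<le> g\<close> makes even the window with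
      \<open>l = 0\<close> an admissible candidate.\<close>
    have "waiting_time \<delta> n x \<omega> \<le> enat (l * (n + g) + g)"
      using l x g by (intro waiting_time_le) (auto simp: match_def)
    then obtain k where k: "waiting_time \<delta> n x \<omega> = enat k" "k \<le> l * (n + g) + g"
      by (metis enat_ile enat_ord_simps(1))
    have "l * (n + g) + g \<le> Suc l * (n + g)" by simp
    also have "\<dots> \<le> m * (n + g)" using l by (intro mult_right_mono) auto
    finally have "real k \<le> real m * real (n + g)" using k(2) by (metis of_nat_le_iff of_nat_mult order_trans)
    also have "\<dots> \<le> exp r / (?w * real (n + g)) * real (n + g)" using m by (intro mult_right_mono) auto
    also have "\<dots> = exp r / ?w" using ng by simp
    finally have up: "real k \<le> exp r / ?w" .
    have k1: "1 \<le> k" using waiting_time_eq_enatD(1)[OF k(1)] .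
    have "match \<delta> n a k \<omega>" unfolding match_def using waiting_time_eq_enatD(2)[OF k(1)] x by metis
    then have "\<not> k \<le> K" using \<omega> k1 by (auto simp: E1_def)
    then have lo: "exp (- r) / ?w \<le> real k" using K by simp
    have "ln (real k) \<le> ln (exp r / ?w)" using up k1 w by (intro iffD2[OF ln_le_cancel_iff]) auto
    moreover have "ln (exp (- r) / ?w) \<le> ln (real k)" using lo k1 w by (intro iffD2[OF ln_le_cancel_iff]) auto
    ultimately show ?thesis using k k1 w by (simp add: ln_div abs_le_iff)
  qed
  ultimately show ?thesis
    using ev by (intro bexI[of _ "E1 \<union> E2"]) auto
qed

end

section \<open>Second moments of additive functionals\<close>

lemma (in prob_space) expectation_finite_valued:
  fixes g :: "'b::finite \<Rightarrow> real"
  assumes Y: "\<And>y. {\<omega> \<in> space M. Y \<omega> = y} \<in> events"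
  shows "integrable M (\<lambda>\<omega>. g (Y \<omega>))"
    and "expectation (\<lambda>\<omega>. g (Y \<omega>)) = (\<Sum>y\<in>UNIV. prob {\<omega> \<in> space M. Y \<omega> = y} * g y)"
proof -
  have eq: "g (Y \<omega>) = (\<Sum>y\<in>UNIV. g y * indicator {\<omega> \<in> space M. Y \<omega> = y} \<omega>)" if "\<omega> \<in> space M" for \<omega>
    using that by (simp add: indicator_def if_distrib cong: if_cong)
  have int: "integrable M (\<lambda>\<omega>. g y * indicator {\<omega> \<in> space M. Y \<omega> = y} \<omega>)" for y
    using Y by (intro integrable_mult_right) (auto simp: integrable_indicator_iff emeasure_eq_measure)
  have "integrable M (\<lambda>\<omega>. \<Sum>y\<in>UNIV. g y * indicator {\<omega> \<in> space M. Y \<omega> = y} \<omega>)"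
    using int by (rule Bochner_Integration.integrable_sum)
  then show "integrable M (\<lambda>\<omega>. g (Y \<omega>))"
    by (subst Bochner_Integration.integrable_cong[OF refl eq])
  have "expectation (\<lambda>\<omega>. g (Y \<omega>)) = expectation (\<lambda>\<omega>. \<Sum>y\<in>UNIV. g y * indicator {\<omega> \<in> space M. Y \<omega> = y} \<omega>)"
    by (rule Bochner_Integration.integral_cong[OF refl eq])
  also have "\<dots> = (\<Sum>y\<in>UNIV. expectation (\<lambda>\<omega>. g y * indicator {\<omega> \<in> space M. Y \<omega> = y} \<omega>))"
    using int by (rule Bochner_Integration.integral_sum)
  also have "\<dots> = (\<Sum>y\<in>UNIV. prob {\<omega> \<in> space M. Y \<omega> = y} * g y)"
    using Y by (intro sum.cong refl) (simp add: mult.commute Int_absorb1)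
  finally show "expectation (\<lambda>\<omega>. g (Y \<omega>)) = (\<Sum>y\<in>UNIV. prob {\<omega> \<in> space M. Y \<omega> = y} * g y)" .
qed

lemma sum_UNIV_prod:
  "(\<Sum>z\<in>UNIV. f z) = (\<Sum>x\<in>UNIV. \<Sum>y\<in>UNIV. f (x::'a::finite, y::'b::finite))"
  by (simp add: UNIV_Times_UNIV[symmetric] sum.cartesian_product del: UNIV_Times_UNIV)

text \<open>Correlations contract once per block of \<open>m\<close> grid steps. The range is
  enlarged to \<open>n * m\<close> so that it splits into complete blocks, on each of which the
  exponent is constant.\<close>

lemma sum_power_div_le:
  fixes q :: real
  assumes q: "0 \<le> q" "q < 1" and m: "1 \<le> m"
  shows "(\<Sum>k<n. q ^ (k div m)) \<le> real m / (1 - q)"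
proof -
  have "(\<Sum>k<n. q ^ (k div m)) \<le> (\<Sum>k<n * m. q ^ (k div m))"
    using q m by (intro sum_mono2) auto
  also have "(\<Sum>k<n * m. q ^ (k div m)) = (\<Sum>l<n. \<Sum>k\<in>{l * m..<l * m + m}. q ^ (k div m))"
    by (rule sum.nat_group[symmetric])
  also have "\<dots> = (\<Sum>l<n. real m * q ^ l)"
  proof (rule sum.cong[OF refl])
    fix l
    have "(\<Sum>k\<in>{l * m..<l * m + m}. q ^ (k div m)) = (\<Sum>k\<in>{l * m..<l * m + m}. q ^ l)"
    proof (intro sum.cong refl arg_cong[where f="\<lambda>j. q ^ j"])
      fix k assume "k \<in> {l * m..<l * m + m}"
      then show "k div m = l" by (intro div_nat_eqI) (auto simp: mult.commute)
    qed
    then show "(\<Sum>k\<in>{l * m..<l * m + m}. q ^ (k div m)) = real m * q ^ l" by simp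
  qed
  also have "\<dots> = real m * (\<Sum>l<n. q ^ l)" by (simp add: sum_distrib_left)
  also have "(\<Sum>l<n. q ^ l) \<le> (\<Sum>l. q ^ l)" using q by (intro sum_le_suminf summable_geometric) auto
  also have "\<dots> = 1 / (1 - q)" using q by (simp add: suminf_geometric)
  finally show ?thesis by (simp add: mult_left_mono)
qed

section \<open>Decay of correlations and the variance bound\<close>

context stationary_markov
begin

lemma R_sum_abs_le:
  assumes "0 \<le> t" "\<And>y. \<bar>\<eta> y\<bar> \<le> b"
  shows "\<bar>\<Sum>y\<in>UNIV. R t x y * \<eta> y\<bar> \<le> b"
proof -
  have "\<bar>\<Sum>y\<in>UNIV. R t x y * \<eta> y\<bar> \<le> (\<Sum>y\<in>UNIV. R t x y * b)"
    using assms R_nonneg[OF assms(1)]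
    by (intro order_trans[OF sum_abs] sum_mono) (simp add: abs_mult mult_left_mono)
  then show ?thesis using R_row_sum[OF assms(1)] by (simp flip: sum_distrib_right)
qed

lemma stat_sum:
  assumes "0 \<le> t"
  shows "(\<Sum>x\<in>UNIV. pmf \<mu> x * (\<Sum>y\<in>UNIV. R t x y * \<eta> y)) = (\<Sum>y\<in>UNIV. pmf \<mu> y * \<eta> y)"
proof -
  have "(\<Sum>x\<in>UNIV. pmf \<mu> x * (\<Sum>y\<in>UNIV. R t x y * \<eta> y)) = (\<Sum>y\<in>UNIV. \<Sum>x\<in>UNIV. pmf \<mu> x * R t x y * \<eta> y)"
    unfolding sum_distrib_left by (subst sum.swap) (simp add: mult_ac)
  then show ?thesis using stat[OF assms] by (simp flip: sum_distrib_right)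
qed

text \<open>Doeblin's argument: subtracting \<open>\<kappa> * \<mu>\<close> from every row of \<open>R t\<close> leaves a nonnegative kernel of
  mass \<open>1 - \<kappa>\<close> that acts in the same way on functions of \<open>\<mu>\<close>-mean zero.\<close>

lemma R_contracts:
  assumes t: "0 \<le> t" "\<And>x y. \<kappa> \<le> R t x y" and \<kappa>: "0 \<le> \<kappa>"
    and \<eta>: "\<And>y. \<bar>\<eta> y\<bar> \<le> b" "(\<Sum>y\<in>UNIV. pmf \<mu> y * \<eta> y) = 0"
  shows "\<bar>\<Sum>y\<in>UNIV. R t x y * \<eta> y\<bar> \<le> (1 - \<kappa>) * b"
proof -
  have "(\<Sum>y\<in>UNIV. R t x y * \<eta> y) = (\<Sum>y\<in>UNIV. R t x y * \<eta> y) - \<kappa> * (\<Sum>y\<in>UNIV. pmf \<mu> y * \<eta> y)"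
    using \<eta>(2) by simp
  also have "\<dots> = (\<Sum>y\<in>UNIV. (R t x y - \<kappa> * pmf \<mu> y) * \<eta> y)"
    by (simp add: sum_distrib_left sum_subtractf algebra_simps)
  also have "\<bar>\<dots>\<bar> \<le> (\<Sum>y\<in>UNIV. (R t x y - \<kappa> * pmf \<mu> y) * b)"
  proof (intro order_trans[OF sum_abs] sum_mono)
    fix y
    have "\<kappa> * pmf \<mu> y \<le> \<kappa> * 1" using \<kappa> by (intro mult_left_mono pmf_le_1)
    then have "0 \<le> R t x y - \<kappa> * pmf \<mu> y" using t(2)[of x y] by simp
    then show "\<bar>(R t x y - \<kappa> * pmf \<mu> y) * \<eta> y\<bar> \<le> (R t x y - \<kappa> * pmf \<mu> y) * b"
      using \<eta>(1) by (simp add: abs_mult mult_left_mono)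
  qed
  also have "\<dots> = (1 - \<kappa>) * b"
    using R_row_sum[OF t(1)] by (simp add: sum_subtractf sum_pmf_eq_1 flip: sum_distrib_left sum_distrib_right)
  finally show ?thesis .
qed

text \<open>Peel off one block of \<open>m\<close> steps. The function left after the other
  \<open>k - m\<close> steps is again centred, by stationarity, and small by the induction
  hypothesis, so the contraction estimate applies to it.\<close>

lemma R_geometric_decay:
  assumes \<delta>: "0 \<le> \<delta>" and m: "1 \<le> m" "\<And>x y. \<kappa> \<le> R (real m * \<delta>) x y" and \<kappa>: "0 \<le> \<kappa>"
    and \<eta>: "\<And>y. \<bar>\<eta> y\<bar> \<le> b" "(\<Sum>y\<in>UNIV. pmf \<mu> y * \<eta> y) = 0"
  shows "\<bar>\<Sum>y\<in>UNIV. R (real k * \<delta>) x y * \<eta> y\<bar> \<le> (1 - \<kappa>) ^ (k div m) * b"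
proof (induction k arbitrary: x rule: less_induct)
  case (less k)
  show ?case
  proof (cases "k < m")
    case True
    then show ?thesis using R_sum_abs_le[of "real k * \<delta>" \<eta> b] \<eta> \<delta> by simp
  next
    case False
    define \<eta>' where "\<eta>' z = (\<Sum>y\<in>UNIV. R (real (k - m) * \<delta>) z y * \<eta> y)" for z
    have split: "real k * \<delta> = real m * \<delta> + real (k - m) * \<delta>"
      using False by (simp add: of_nat_diff algebra_simps)
    have "(\<Sum>y\<in>UNIV. R (real k * \<delta>) x y * \<eta> y) = (\<Sum>z\<in>UNIV. R (real m * \<delta>) x z * \<eta>' z)"
      unfolding split \<eta>'_def using \<delta>
      by (simp add: chapman_kolmogorov sum_distrib_left sum_distrib_right mult_ac del: of_nat_diff)
        (subst sum.swap, rule refl)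
    moreover have "\<bar>\<eta>' z\<bar> \<le> (1 - \<kappa>) ^ ((k - m) div m) * b" for z
      unfolding \<eta>'_def using less[of "k - m"] False m by simp
    moreover have "(\<Sum>z\<in>UNIV. pmf \<mu> z * \<eta>' z) = 0"
      unfolding \<eta>'_def using \<delta> \<eta>(2) by (simp add: stat_sum)
    ultimately have "\<bar>\<Sum>y\<in>UNIV. R (real k * \<delta>) x y * \<eta> y\<bar> \<le> (1 - \<kappa>) * ((1 - \<kappa>) ^ ((k - m) div m) * b)"
      using R_contracts[of "real m * \<delta>" \<kappa> \<eta>'] \<delta> m \<kappa> by simp
    moreover have "k div m = Suc ((k - m) div m)" using False m by (simp add: le_div_geq)
    ultimately show ?thesis by simp
  qed
qed

lemma prob_four:
  assumes "0 \<le> s" "s \<le> t" "t \<le> u" "u \<le> v"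
  shows "prob {\<omega> \<in> space P. (\<omega> s, \<omega> t, \<omega> u, \<omega> v) = (x, y, z, w)} =
    pmf \<mu> x * R (t - s) x y * R (u - t) y z * R (v - u) z w"
proof -
  have "{\<omega> \<in> space P. \<forall>i\<le>3. \<omega> ([s, t, u, v] ! i) = [x, y, z, w] ! i} =
      {\<omega> \<in> space P. (\<omega> s, \<omega> t, \<omega> u, \<omega> v) = (x, y, z, w)}"
    by (auto simp: le_Suc_eq numeral_3_eq_3)
  moreover have "prob {\<omega> \<in> space P. \<forall>i\<le>3. \<omega> ([s, t, u, v] ! i) = [x, y, z, w] ! i} =
      pmf \<mu> x * R (t - s) x y * R (u - t) y z * R (v - u) z w"
    using assms by (subst fdd) (auto simp: numeral_3_eq_3 less_Suc_eq)
  ultimately show ?thesis by simp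
qed

lemma tuple_event:
  assumes "0 \<le> s" "0 \<le> t" "0 \<le> u" "0 \<le> v"
  shows "{\<omega> \<in> space P. (\<omega> s, \<omega> t, \<omega> u, \<omega> v) = z} \<in> events"
proof (cases z)
  case (fields a b c d)
  show ?thesis unfolding fields prod.inject
    using assms by (intro sets.sets_Collect_conj eval_event) auto
qed

text \<open>The inequalities between the times are weak on purpose: \<open>t = u\<close> covers two
  consecutive steps, and a constant \<open>h\<close> with coinciding times gives the expectation for
  a single step.\<close>

lemma expectation_four:
  assumes "0 \<le> s" "s \<le> t" "t \<le> u" "u \<le> v"
  shows "expectation (\<lambda>\<omega>. f (\<omega> s) (\<omega> t) * h (\<omega> u) (\<omega> v)) =
    (\<Sum>x\<in>UNIV. pmf \<mu> x * (\<Sum>y\<in>UNIV. R (t - s) x y * (f x y *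
      (\<Sum>z\<in>UNIV. R (u - t) y z * (\<Sum>w\<in>UNIV. R (v - u) z w * h z w)))))"
proof -
  have "expectation (\<lambda>\<omega>. (\<lambda>(x, y, z, w). f x y * h z w) (\<omega> s, \<omega> t, \<omega> u, \<omega> v)) =
      (\<Sum>q\<in>UNIV. prob {\<omega> \<in> space P. (\<omega> s, \<omega> t, \<omega> u, \<omega> v) = q} * (\<lambda>(x, y, z, w). f x y * h z w) q)"
    using assms by (intro expectation_finite_valued(2) tuple_event) auto
  also have "\<dots> = (\<Sum>x\<in>UNIV. \<Sum>y\<in>UNIV. \<Sum>z\<in>UNIV. \<Sum>w\<in>UNIV.
      pmf \<mu> x * R (t - s) x y * R (u - t) y z * R (v - u) z w * (f x y * h z w))"
    unfolding sum_UNIV_prod prob_four[OF assms] by simp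
  finally show ?thesis by (simp add: sum_distrib_left mult_ac)
qed

lemma integrable_four:
  fixes f :: "'a \<Rightarrow> 'a \<Rightarrow> 'a \<Rightarrow> 'a \<Rightarrow> real"
  assumes "0 \<le> s" "0 \<le> t" "0 \<le> u" "0 \<le> v"
  shows "integrable P (\<lambda>\<omega>. f (\<omega> s) (\<omega> t) (\<omega> u) (\<omega> v))"
proof -
  have "integrable P (\<lambda>\<omega>. (\<lambda>(x, y, z, w). f x y z w) (\<omega> s, \<omega> t, \<omega> u, \<omega> v))"
    using tuple_event[OF assms] by (rule expectation_finite_valued(1))
  then show ?thesis by simp
qed

text \<open>One factor of the square is bounded by \<open>M\<close> and the other is integrated. As
  \<open>b\<close> will be of order \<delta>, the second moment of a step is O(\<delta>), although
  single values of the functional need not be small.\<close>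

lemma expectation_square_step:
  assumes \<delta>: "0 \<le> \<delta>"
    and M: "\<And>x y. \<bar>\<zeta> x y\<bar> \<le> M" and b: "\<And>x. (\<Sum>y\<in>UNIV. R \<delta> x y * \<bar>\<zeta> x y\<bar>) \<le> b"
    and s: "0 \<le> s"
  shows "expectation (\<lambda>\<omega>. (\<zeta> (\<omega> s) (\<omega> (s + \<delta>)))\<^sup>2) \<le> M * b"
proof -
  have "expectation (\<lambda>\<omega>. (\<zeta> (\<omega> s) (\<omega> (s + \<delta>)))\<^sup>2 * 1) =
    (\<Sum>x\<in>UNIV. pmf \<mu> x * (\<Sum>y\<in>UNIV. R \<delta> x y * (\<zeta> x y)\<^sup>2))"
    using expectation_four[of s "s + \<delta>" "s + \<delta>" "s + \<delta>" "\<lambda>x y. (\<zeta> x y)\<^sup>2" "\<lambda>_ _. 1"] \<delta> s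
    by (simp add: R_row_sum)
  also have "\<dots> \<le> (\<Sum>x\<in>UNIV. pmf \<mu> x * (M * b))"
  proof (intro sum_mono mult_left_mono)
    fix x
    have M0: "0 \<le> M" using M[of x x] by linarith
    have "(\<Sum>y\<in>UNIV. R \<delta> x y * (\<zeta> x y)\<^sup>2) \<le> (\<Sum>y\<in>UNIV. M * (R \<delta> x y * \<bar>\<zeta> x y\<bar>))"
    proof (rule sum_mono)
      fix y
      have "(\<zeta> x y)\<^sup>2 = \<bar>\<zeta> x y\<bar> * \<bar>\<zeta> x y\<bar>" by (simp add: power2_eq_square)
      also have "\<dots> \<le> M * \<bar>\<zeta> x y\<bar>" using M by (intro mult_right_mono) auto
      finally show "R \<delta> x y * (\<zeta> x y)\<^sup>2 \<le> M * (R \<delta> x y * \<bar>\<zeta> x y\<bar>)"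
        using R_nonneg[OF \<delta>, of x y] by (metis mult.left_commute mult_left_mono)
    qed
    also have "\<dots> \<le> M * b" using b M0 by (simp add: mult_left_mono flip: sum_distrib_left)
    finally show "(\<Sum>y\<in>UNIV. R \<delta> x y * (\<zeta> x y)\<^sup>2) \<le> M * b" .
  qed simp
  also have "\<dots> = M * b" by (simp add: sum_pmf_eq_1 flip: sum_distrib_right)
  finally show ?thesis by simp
qed

text \<open>Conditionally on its starting state the later step has mean \<open>\<eta>\<close>, which
  is bounded by \<open>b\<close> and has \<mu>-mean zero, so it decays over the
  \<open>j - Suc i\<close> grid steps that separate the two transitions. The earlier step
  contributes the second factor \<open>b\<close>.\<close>

lemma expectation_step_product_le:
  assumes \<delta>: "0 \<le> \<delta>" and m: "1 \<le> m" "\<And>x y. \<kappa> \<le> R (real m * \<delta>) x y" and \<kappa>: "0 \<le> \<kappa>"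
    and b: "\<And>x. (\<Sum>y\<in>UNIV. R \<delta> x y * \<bar>\<zeta> x y\<bar>) \<le> b"
    and mean: "(\<Sum>x\<in>UNIV. pmf \<mu> x * (\<Sum>y\<in>UNIV. R \<delta> x y * \<zeta> x y)) = 0"
    and ij: "i < j"
  shows "expectation (\<lambda>\<omega>. \<zeta> (\<omega> (real (Suc i) * \<delta>)) (\<omega> (real (Suc (Suc i)) * \<delta>)) *
      \<zeta> (\<omega> (real (Suc j) * \<delta>)) (\<omega> (real (Suc (Suc j)) * \<delta>))) \<le> b\<^sup>2 * (1 - \<kappa>) ^ ((j - Suc i) div m)"
proof -
  define \<eta> where "\<eta> z = (\<Sum>w\<in>UNIV. R \<delta> z w * \<zeta> z w)" for z
  define B where "B = (1 - \<kappa>) ^ ((j - Suc i) div m) * b"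
  have \<kappa>1: "\<kappa> \<le> 1" using m(2) R_le_1[of "real m * \<delta>"] \<delta> by (meson mult_nonneg_nonneg of_nat_0_le_iff order_trans)
  have b0: "0 \<le> b" by (rule order_trans[OF _ b[of undefined]]) (auto intro!: sum_nonneg mult_nonneg_nonneg R_nonneg \<delta>)
  have \<eta>: "\<bar>\<eta> z\<bar> \<le> b" for z
    unfolding \<eta>_def
    by (rule order_trans[OF sum_abs order_trans[OF _ b[of z]]])
      (auto simp: abs_mult R_nonneg[OF \<delta>])
  have d: "real (Suc (Suc k)) * \<delta> - real (Suc k) * \<delta> = \<delta>" for k by (simp add: algebra_simps)
  have dij: "real (Suc j) * \<delta> - real (Suc (Suc i)) * \<delta> = real (j - Suc i) * \<delta>"
    using ij by (simp add: of_nat_diff algebra_simps)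
  have times: "0 \<le> real (Suc i) * \<delta>" "real (Suc i) * \<delta> \<le> real (Suc (Suc i)) * \<delta>"
    "real (Suc (Suc i)) * \<delta> \<le> real (Suc j) * \<delta>" "real (Suc j) * \<delta> \<le> real (Suc (Suc j)) * \<delta>"
    using \<delta> ij by (auto intro!: mult_right_mono)
  have dec: "\<bar>\<Sum>z\<in>UNIV. R (real (j - Suc i) * \<delta>) y z * \<eta> z\<bar> \<le> B" for y
    unfolding B_def using mean by (intro R_geometric_decay \<delta> m \<kappa> \<eta>) (simp add: \<eta>_def)
  have "expectation (\<lambda>\<omega>. \<zeta> (\<omega> (real (Suc i) * \<delta>)) (\<omega> (real (Suc (Suc i)) * \<delta>)) *
      \<zeta> (\<omega> (real (Suc j) * \<delta>)) (\<omega> (real (Suc (Suc j)) * \<delta>))) =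
    (\<Sum>x\<in>UNIV. pmf \<mu> x * (\<Sum>y\<in>UNIV. R \<delta> x y * (\<zeta> x y * (\<Sum>z\<in>UNIV. R (real (j - Suc i) * \<delta>) y z * \<eta> z))))"
    unfolding \<eta>_def using times by (subst expectation_four) (simp_all only: d dij)
  also have "\<dots> \<le> (\<Sum>x\<in>UNIV. pmf \<mu> x * (b * B))"
  proof (intro sum_mono mult_left_mono)
    fix x
    have "(\<Sum>y\<in>UNIV. R \<delta> x y * (\<zeta> x y * (\<Sum>z\<in>UNIV. R (real (j - Suc i) * \<delta>) y z * \<eta> z))) \<le>
        (\<Sum>y\<in>UNIV. (R \<delta> x y * \<bar>\<zeta> x y\<bar>) * B)"
    proof (rule sum_mono)
      fix y
      let ?s = "\<Sum>z\<in>UNIV. R (real (j - Suc i) * \<delta>) y z * \<eta> z"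
      have "\<zeta> x y * ?s \<le> \<bar>\<zeta> x y\<bar> * \<bar>?s\<bar>" by (metis abs_ge_self abs_mult)
      also have "\<dots> \<le> \<bar>\<zeta> x y\<bar> * B" using dec by (intro mult_left_mono) auto
      finally have "R \<delta> x y * (\<zeta> x y * ?s) \<le> R \<delta> x y * (\<bar>\<zeta> x y\<bar> * B)"
        using R_nonneg[OF \<delta>] by (rule mult_left_mono)
      then show "R \<delta> x y * (\<zeta> x y * ?s) \<le> (R \<delta> x y * \<bar>\<zeta> x y\<bar>) * B" by (simp only: mult.assoc)
    qed
    also have "\<dots> \<le> b * B"
      unfolding sum_distrib_right[symmetric] using b b0 \<kappa>1 by (intro mult_right_mono) (auto simp: B_def)
    finally show "(\<Sum>y\<in>UNIV. R \<delta> x y * (\<zeta> x y * (\<Sum>z\<in>UNIV. R (real (j - Suc i) * \<delta>) y z * \<eta> z))) \<le> b * B" .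
  qed simp
  also have "\<dots> = b * B" by (simp add: sum_pmf_eq_1 flip: sum_distrib_right)
  finally show ?thesis by (simp add: B_def power2_eq_square mult_ac)
qed

text \<open>Each new step adds its own second moment, at most \<open>M * b\<close>, and twice its
  covariances with all earlier steps, a geometric series over blocks of length \<open>m\<close>.
  With \<open>b\<close> of order \<delta> and \<open>m\<close> of order 1 / \<delta>, both
  contributions are O(\<delta>). Step \<open>i\<close> starts at time
  \<open>real (Suc i) * \<delta>\<close> because the observed word starts at \<delta>.\<close>

lemma expectation_step_sum_square_le:
  assumes \<delta>: "0 \<le> \<delta>" and m: "1 \<le> m" "\<And>x y. \<kappa> \<le> R (real m * \<delta>) x y" and \<kappa>: "0 < \<kappa>"
    and M: "\<And>x y. \<bar>\<zeta> x y\<bar> \<le> M" and b: "\<And>x. (\<Sum>y\<in>UNIV. R \<delta> x y * \<bar>\<zeta> x y\<bar>) \<le> b"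
    and mean: "(\<Sum>x\<in>UNIV. pmf \<mu> x * (\<Sum>y\<in>UNIV. R \<delta> x y * \<zeta> x y)) = 0"
  shows "integrable P (\<lambda>\<omega>. (\<Sum>i<n. \<zeta> (\<omega> (real (Suc i) * \<delta>)) (\<omega> (real (Suc (Suc i)) * \<delta>)))\<^sup>2)"
    and "expectation (\<lambda>\<omega>. (\<Sum>i<n. \<zeta> (\<omega> (real (Suc i) * \<delta>)) (\<omega> (real (Suc (Suc i)) * \<delta>)))\<^sup>2)
      \<le> real n * (M * b + 2 * b\<^sup>2 * real m / \<kappa>)"
proof -
  define Z where "Z i \<omega> = \<zeta> (\<omega> (real (Suc i) * \<delta>)) (\<omega> (real (Suc (Suc i)) * \<delta>))" for i and \<omega> :: "real \<Rightarrow> 'a"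
  have int: "integrable P (\<lambda>\<omega>. Z i \<omega> * Z j \<omega>)" for i j
    unfolding Z_def using \<delta>
    by (intro integrable_four[where f="\<lambda>x y z w. \<zeta> x y * \<zeta> z w"]) auto
  have sq: "(\<Sum>i<n. Z i \<omega>)\<^sup>2 = (\<Sum>i<n. \<Sum>j<n. Z i \<omega> * Z j \<omega>)" for n \<omega>
    by (simp add: power2_eq_square sum_product)
  have int2: "integrable P (\<lambda>\<omega>. (\<Sum>i<n. Z i \<omega>)\<^sup>2)" for n
    unfolding sq by (intro Bochner_Integration.integrable_sum int)
  then show "integrable P (\<lambda>\<omega>. (\<Sum>i<n. \<zeta> (\<omega> (real (Suc i) * \<delta>)) (\<omega> (real (Suc (Suc i)) * \<delta>)))\<^sup>2)"
    by (simp add: Z_def)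
  have \<kappa>1: "\<kappa> \<le> 1" using m(2) R_le_1[of "real m * \<delta>"] \<delta> by (meson mult_nonneg_nonneg of_nat_0_le_iff order_trans)
  have "expectation (\<lambda>\<omega>. (\<Sum>i<n. Z i \<omega>)\<^sup>2) \<le> real n * (M * b + 2 * b\<^sup>2 * real m / \<kappa>)"
  proof (induction n)
    case 0
    then show ?case by simp
  next
    case (Suc n)
    have "(\<Sum>i<Suc n. Z i \<omega>)\<^sup>2 = (\<Sum>i<n. Z i \<omega>)\<^sup>2 + 2 * (\<Sum>i<n. Z i \<omega> * Z n \<omega>) + Z n \<omega> * Z n \<omega>" for \<omega>
      by (simp add: power2_sum power2_eq_square algebra_simps flip: sum_distrib_right)
    then have "expectation (\<lambda>\<omega>. (\<Sum>i<Suc n. Z i \<omega>)\<^sup>2) =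
        expectation (\<lambda>\<omega>. (\<Sum>i<n. Z i \<omega>)\<^sup>2) + 2 * (\<Sum>i<n. expectation (\<lambda>\<omega>. Z i \<omega> * Z n \<omega>))
        + expectation (\<lambda>\<omega>. Z n \<omega> * Z n \<omega>)"
      using int int2 by (simp add: Bochner_Integration.integral_sum)
    moreover have "(\<Sum>i<n. expectation (\<lambda>\<omega>. Z i \<omega> * Z n \<omega>)) \<le> b\<^sup>2 * real m / \<kappa>"
    proof -
      have "(\<Sum>i<n. expectation (\<lambda>\<omega>. Z i \<omega> * Z n \<omega>)) \<le> (\<Sum>i<n. b\<^sup>2 * (1 - \<kappa>) ^ ((n - Suc i) div m))"
        unfolding Z_def using \<kappa> by (intro sum_mono expectation_step_product_le \<delta> m b mean) auto
      also have "\<dots> = b\<^sup>2 * (\<Sum>k<n. (1 - \<kappa>) ^ (k div m))"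
        by (simp add: sum.nat_diff_reindex[of "\<lambda>k. (1 - \<kappa>) ^ (k div m)" n] flip: sum_distrib_left)
      also have "\<dots> \<le> b\<^sup>2 * (real m / \<kappa>)"
        using sum_power_div_le[of "1 - \<kappa>" m n] \<kappa> \<kappa>1 m by (intro mult_left_mono) auto
      finally show ?thesis by simp
    qed
    moreover have "expectation (\<lambda>\<omega>. Z n \<omega> * Z n \<omega>) \<le> M * b"
      using expectation_square_step[OF \<delta> M b, of "real (Suc n) * \<delta>"] \<delta>
      by (simp add: Z_def power2_eq_square algebra_simps)
    moreover have "real (Suc n) * (M * b + 2 * b\<^sup>2 * real m / \<kappa>) =
        real n * (M * b + 2 * b\<^sup>2 * real m / \<kappa>) + 2 * (b\<^sup>2 * real m / \<kappa>) + M * b"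
      by (simp add: algebra_simps add_divide_distrib)
    ultimately show ?case using Suc by linarith
  qed
  then show "expectation (\<lambda>\<omega>. (\<Sum>i<n. \<zeta> (\<omega> (real (Suc i) * \<delta>)) (\<omega> (real (Suc (Suc i)) * \<delta>)))\<^sup>2)
      \<le> real n * (M * b + 2 * b\<^sup>2 * real m / \<kappa>)" by (simp add: Z_def)
qed

text \<open>Chebyshev's inequality for the centred functional. Centring at most doubles the bounds
  \<open>M\<close> and \<open>b\<close>, whence the constants 4 and 8.\<close>

lemma prob_step_sum_deviation:
  assumes \<delta>: "0 \<le> \<delta>" and m: "1 \<le> m" "\<And>x y. \<kappa> \<le> R (real m * \<delta>) x y" and \<kappa>: "0 < \<kappa>"
    and M: "\<And>x y. \<bar>f x y\<bar> \<le> M" and b: "\<And>x. (\<Sum>y\<in>UNIV. R \<delta> x y * \<bar>f x y\<bar>) \<le> b"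
    and r: "0 < r"
  defines "mean \<equiv> \<Sum>x\<in>UNIV. pmf \<mu> x * (\<Sum>y\<in>UNIV. R \<delta> x y * f x y)"
  shows "{\<omega> \<in> space P. r \<le> \<bar>(\<Sum>i<n. f (\<omega> (real (Suc i) * \<delta>)) (\<omega> (real (Suc (Suc i)) * \<delta>))) - real n * mean\<bar>} \<in> events"
    and "prob {\<omega> \<in> space P. r \<le> \<bar>(\<Sum>i<n. f (\<omega> (real (Suc i) * \<delta>)) (\<omega> (real (Suc (Suc i)) * \<delta>))) - real n * mean\<bar>}
      \<le> real n * (4 * M * b + 8 * b\<^sup>2 * real m / \<kappa>) / r\<^sup>2"
proof -
  define \<zeta> where "\<zeta> x y = f x y - mean" for x y
  have fb: "\<bar>\<Sum>y\<in>UNIV. R \<delta> x y * f x y\<bar> \<le> b" for x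
    by (rule order_trans[OF sum_abs order_trans[OF _ b[of x]]])
      (auto simp: abs_mult R_nonneg[OF \<delta>])
  have avg: "\<bar>\<Sum>x\<in>UNIV. pmf \<mu> x * h x\<bar> \<le> B" if "\<And>x. \<bar>h x\<bar> \<le> B" for h :: "'a \<Rightarrow> real" and B
  proof -
    have "\<bar>\<Sum>x\<in>UNIV. pmf \<mu> x * h x\<bar> \<le> (\<Sum>x\<in>UNIV. pmf \<mu> x * B)"
      using that by (intro order_trans[OF sum_abs] sum_mono) (simp add: abs_mult mult_left_mono)
    then show ?thesis by (simp add: sum_pmf_eq_1 flip: sum_distrib_right)
  qed
  have mb: "\<bar>mean\<bar> \<le> b" unfolding mean_def by (rule avg[OF fb])
  have mM: "\<bar>mean\<bar> \<le> M" unfolding mean_def using M \<delta> by (intro avg R_sum_abs_le)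
  have "\<bar>\<zeta> x y\<bar> \<le> 2 * M" for x y using M[of x y] mM unfolding \<zeta>_def by linarith
  moreover have "(\<Sum>y\<in>UNIV. R \<delta> x y * \<bar>\<zeta> x y\<bar>) \<le> 2 * b" for x
  proof -
    have "(\<Sum>y\<in>UNIV. R \<delta> x y * \<bar>\<zeta> x y\<bar>) \<le> (\<Sum>y\<in>UNIV. R \<delta> x y * (\<bar>f x y\<bar> + b))"
    proof (intro sum_mono mult_left_mono R_nonneg[OF \<delta>])
      show "\<bar>\<zeta> x y\<bar> \<le> \<bar>f x y\<bar> + b" for y using mb unfolding \<zeta>_def by linarith
    qed
    also have "\<dots> = (\<Sum>y\<in>UNIV. R \<delta> x y * \<bar>f x y\<bar>) + b"
      using R_row_sum[OF \<delta>, of x] by (simp add: distrib_left sum.distrib flip: sum_distrib_right)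
    finally show ?thesis using b[of x] by simp
  qed
  moreover have "(\<Sum>x\<in>UNIV. pmf \<mu> x * (\<Sum>y\<in>UNIV. R \<delta> x y * \<zeta> x y)) = 0"
    using R_row_sum[OF \<delta>] unfolding \<zeta>_def
    by (simp add: right_diff_distrib sum_subtractf sum_pmf_eq_1 flip: sum_distrib_right)
      (simp add: mean_def)
  ultimately have int: "integrable P (\<lambda>\<omega>. (\<Sum>i<n. \<zeta> (\<omega> (real (Suc i) * \<delta>)) (\<omega> (real (Suc (Suc i)) * \<delta>)))\<^sup>2)"
    and le: "expectation (\<lambda>\<omega>. (\<Sum>i<n. \<zeta> (\<omega> (real (Suc i) * \<delta>)) (\<omega> (real (Suc (Suc i)) * \<delta>)))\<^sup>2)
      \<le> real n * (2 * M * (2 * b) + 2 * (2 * b)\<^sup>2 * real m / \<kappa>)"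
    using expectation_step_sum_square_le[OF \<delta> m \<kappa>, of \<zeta> "2 * M" "2 * b"] by blast+
  define S where "S \<omega> = (\<Sum>i<n. \<zeta> (\<omega> (real (Suc i) * \<delta>)) (\<omega> (real (Suc (Suc i)) * \<delta>)))" for \<omega> :: "real \<Rightarrow> 'a"
  have S: "S \<omega> = (\<Sum>i<n. f (\<omega> (real (Suc i) * \<delta>)) (\<omega> (real (Suc (Suc i)) * \<delta>))) - real n * mean" for \<omega>
    by (simp add: S_def \<zeta>_def sum_subtractf)
  have meas: "S \<in> borel_measurable P"
    unfolding S_def[abs_def]
  proof (rule borel_measurable_sum)
    show "(\<lambda>\<omega>. \<zeta> (\<omega> (real (Suc i) * \<delta>)) (\<omega> (real (Suc (Suc i)) * \<delta>))) \<in> borel_measurable P" for i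
      using integrable_four[of "real (Suc i) * \<delta>" "real (Suc (Suc i)) * \<delta>" 0 0 "\<lambda>x y _ _. \<zeta> x y"] \<delta> by auto
  qed
  have "prob {\<omega> \<in> space P. r \<le> \<bar>S \<omega>\<bar>} \<le> expectation (\<lambda>\<omega>. (S \<omega>)\<^sup>2) / r\<^sup>2"
    using int r unfolding S_def[symmetric] by (intro second_moment_method meas)
  also have "\<dots> \<le> real n * (2 * M * (2 * b) + 2 * (2 * b)\<^sup>2 * real m / \<kappa>) / r\<^sup>2"
    using le unfolding S_def[symmetric] by (intro divide_right_mono) auto
  also have "\<dots> = real n * (4 * M * b + 8 * b\<^sup>2 * real m / \<kappa>) / r\<^sup>2" by (simp add: power2_eq_square)
  finally show "prob {\<omega> \<in> space P. r \<le> \<bar>(\<Sum>i<n. f (\<omega> (real (Suc i) * \<delta>)) (\<omega> (real (Suc (Suc i)) * \<delta>))) - real n * mean\<bar>}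
      \<le> real n * (4 * M * b + 8 * b\<^sup>2 * real m / \<kappa>) / r\<^sup>2" unfolding S .
  show "{\<omega> \<in> space P. r \<le> \<bar>(\<Sum>i<n. f (\<omega> (real (Suc i) * \<delta>)) (\<omega> (real (Suc (Suc i)) * \<delta>))) - real n * mean\<bar>} \<in> events"
    unfolding S[symmetric] using meas by measurable
qed

end

section \<open>Comparison of two chains\<close>

text \<open>This is how independence is used: the first coordinate is split by the finitely many
  values of \<open>h\<close>, and over each fibre the event \<open>E a\<close> in the second
  coordinate is fixed, so the probabilities multiply.\<close>

lemma pair_prob_fiber_le:
  assumes "prob_space M1" "prob_space M2" and S: "finite S"
    and h: "\<And>a. a \<in> S \<Longrightarrow> {\<omega> \<in> space M1. h \<omega> = a} \<in> sets M1"
    and E: "\<And>a. a \<in> S \<Longrightarrow> E a \<in> sets M2" "\<And>a. a \<in> S \<Longrightarrow> measure M2 (E a) \<le> b" and b: "0 \<le> b"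
  defines "A \<equiv> \<Union>a\<in>S. {\<omega> \<in> space M1. h \<omega> = a} \<times> E a"
  shows "A \<in> sets (M1 \<Otimes>\<^sub>M M2)" "measure (M1 \<Otimes>\<^sub>M M2) A \<le> b"
proof -
  interpret M1: prob_space M1 by fact
  interpret M2: prob_space M2 by fact
  interpret pair_prob_space M1 M2 ..
  show "A \<in> sets (M1 \<Otimes>\<^sub>M M2)" using S h E unfolding A_def by auto
  have "measure (M1 \<Otimes>\<^sub>M M2) A \<le> (\<Sum>a\<in>S. measure (M1 \<Otimes>\<^sub>M M2) ({\<omega> \<in> space M1. h \<omega> = a} \<times> E a))"
    unfolding A_def using S h E by (intro measure_UNION_le) auto
  also have "\<dots> \<le> (\<Sum>a\<in>S. M1.prob {\<omega> \<in> space M1. h \<omega> = a} * b)"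
  proof (rule sum_mono)
    fix a assume a: "a \<in> S"
    have "measure (M1 \<Otimes>\<^sub>M M2) ({\<omega> \<in> space M1. h \<omega> = a} \<times> E a) = M1.prob {\<omega> \<in> space M1. h \<omega> = a} * M2.prob (E a)"
      using h[OF a] E(1)[OF a] by (simp add: measure_def M2.emeasure_pair_measure_Times enn2real_mult)
    also have "\<dots> \<le> M1.prob {\<omega> \<in> space M1. h \<omega> = a} * b"
      using E(2)[OF a] by (intro mult_left_mono) auto
    finally show "measure (M1 \<Otimes>\<^sub>M M2) ({\<omega> \<in> space M1. h \<omega> = a} \<times> E a) \<le> M1.prob {\<omega> \<in> space M1. h \<omega> = a} * b" .
  qed
  also have "\<dots> = M1.prob {\<omega> \<in> space M1. h \<omega> \<in> S} * b"
    using M1.prob_sum_values[OF S, of "\<lambda>_. True" h] h by (simp flip: sum_distrib_right)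
  also have "\<dots> \<le> 1 * b" using b by (intro mult_right_mono M1.prob_le_1)
  finally show "measure (M1 \<Otimes>\<^sub>M M2) A \<le> b" by simp
qed

locale two_stationary_markov =
  X: stationary_markov P \<mu> R + Y: stationary_markov P' \<mu>' R'
  for P P' :: "(real \<Rightarrow> 'a::finite) measure" and \<mu> \<mu>' :: "'a pmf" and R R' :: "real \<Rightarrow> 'a \<Rightarrow> 'a \<Rightarrow> real"
begin

lemma ln_word_weight_diff:
  assumes pos: "\<And>x y. 0 < R \<delta> x y" "\<And>x y. 0 < R' \<delta> x y"
  shows "0 < X.word_weight \<delta> n a" "0 < Y.word_weight \<delta> n a"
    and "ln (X.word_weight \<delta> n a) - ln (Y.word_weight \<delta> n a) =
      ln (pmf \<mu> (a 1) / pmf \<mu>' (a 1)) + (\<Sum>i<n - 1. ln (R \<delta> (a (Suc i)) (a (Suc (Suc i))) / R' \<delta> (a (Suc i)) (a (Suc (Suc i)))))"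
proof -
  have prods: "0 < (\<Prod>i<n - 1. R \<delta> (a (Suc i)) (a (Suc (Suc i))))" "0 < (\<Prod>i<n - 1. R' \<delta> (a (Suc i)) (a (Suc (Suc i))))"
    using pos by (auto intro: prod_pos)
  note init = X.init_pos[of "a 1"] Y.init_pos[of "a 1"]
  show "0 < X.word_weight \<delta> n a" "0 < Y.word_weight \<delta> n a"
    unfolding X.word_weight_def Y.word_weight_def using prods init by auto
  show "ln (X.word_weight \<delta> n a) - ln (Y.word_weight \<delta> n a) =
      ln (pmf \<mu> (a 1) / pmf \<mu>' (a 1)) + (\<Sum>i<n - 1. ln (R \<delta> (a (Suc i)) (a (Suc (Suc i))) / R' \<delta> (a (Suc i)) (a (Suc (Suc i)))))"
    unfolding X.word_weight_def Y.word_weight_def using prods init pos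
    by (simp add: ln_mult ln_div ln_prod sum_subtractf less_imp_neq[symmetric])
qed

text \<open>The non-asymptotic form of the result. The tolerance is split into five equal parts
  \<open>r\<close>, for the two waiting times, the first letter, the fluctuation of the additive
  functional and the error in its mean. The first two give the doubled exponential term, the
  fluctuation the last term, and the other two are deterministic assumptions.\<close>

lemma log_ratio_deviation_le:
  assumes \<delta>: "0 < \<delta>" and n: "1 \<le> n" and g: "1 \<le> g"
    and \<kappa>: "0 < \<kappa>" "\<And>x y. \<kappa> \<le> R (real (Suc g) * \<delta>) x y" "\<And>x y. \<kappa> \<le> R' (real (Suc g) * \<delta>) x y"
    and pos: "\<And>x y. 0 < R \<delta> x y" "\<And>x y. 0 < R' \<delta> x y"
    and f: "\<And>x y. f x y = ln (R \<delta> x y / R' \<delta> x y)"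
    and M: "\<And>x y. \<bar>f x y\<bar> \<le> M" and b: "\<And>x. (\<Sum>y\<in>UNIV. R \<delta> x y * \<bar>f x y\<bar>) \<le> b"
    and \<epsilon>: "0 < \<epsilon>" and r: "r = \<epsilon> * (real n * \<delta>) / 5"
    and init: "\<And>x. \<bar>ln (pmf \<mu> x / pmf \<mu>' x)\<bar> \<le> r"
    and mean: "\<bar>real (n - 1) * (\<Sum>x\<in>UNIV. pmf \<mu> x * (\<Sum>y\<in>UNIV. R \<delta> x y * f x y)) - real n * \<delta> * s\<bar> \<le> r"
  defines "V \<equiv> \<lambda>(x, y, x'). waiting_time \<delta> n x y" and "W \<equiv> \<lambda>(x, y, x'). waiting_time \<delta> n x x'"
  shows "measure (P \<Otimes>\<^sub>M P' \<Otimes>\<^sub>M P) {\<omega> \<in> space (P \<Otimes>\<^sub>M P' \<Otimes>\<^sub>M P). V \<omega> = \<infinity> \<or> W \<omega> = \<infinity> \<or>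
      \<bar>1 / (real n * \<delta>) * ln (real (the_enat (V \<omega>)) / real (the_enat (W \<omega>))) - s\<bar> > \<epsilon>}
    \<le> 2 * (exp (- r) + exp (- \<kappa> * (exp r / real (n + g) - 1)))
      + real n * (4 * M * b + 8 * b\<^sup>2 * real (Suc g) / \<kappa>) / r\<^sup>2"
proof -
  interpret YX: pair_prob_space P' P ..
  interpret XYX: pair_prob_space P "P' \<Otimes>\<^sub>M P" ..
  let ?MM = "P \<Otimes>\<^sub>M P' \<Otimes>\<^sub>M P"
  define B where "B = exp (- r) + exp (- \<kappa> * (exp r / real (n + g) - 1))"
  have B0: "0 \<le> B" by (simp add: B_def)
  define h where "h x = (\<lambda>i\<in>{1..n}. x (real i * \<delta>))" for x :: "real \<Rightarrow> 'a"
  define S where "S = {1..n} \<rightarrow>\<^sub>E (UNIV :: 'a set)"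
  have S: "finite S" by (simp add: S_def finite_PiE)
  have hS: "h x \<in> S" for x by (simp add: h_def S_def)
  have h_ev: "{x \<in> space P. h x = a} \<in> X.events" if "a \<in> S" for a
  proof -
    have "a i = undefined" if "i \<notin> {1..n}" for i
      using that \<open>a \<in> S\<close> unfolding S_def by (rule PiE_arb[rotated])
    then have "h x = a \<longleftrightarrow> (\<forall>i\<in>{1..n}. x (real i * \<delta>) = a i)" for x
      by (auto simp: h_def fun_eq_iff restrict_def)
    then show ?thesis using X.cylinder_event[of "{1..n}" "\<lambda>i. real i * \<delta>" a] \<delta> by simp
  qed
  define good where "good = (\<lambda>w (x :: real \<Rightarrow> 'a) \<omega>. waiting_time \<delta> n x \<omega> \<noteq> \<infinity> \<and>
      \<bar>ln (real (the_enat (waiting_time \<delta> n x \<omega>))) + ln w\<bar> \<le> r \<and> 0 < the_enat (waiting_time \<delta> n x \<omega>))"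
  have "\<exists>E. \<forall>a. E a \<in> X.events \<and> X.prob (E a) \<le> B \<and>
      (\<forall>x \<omega>. (\<forall>i\<in>{1..n}. x (real i * \<delta>) = a i) \<longrightarrow> \<omega> \<in> space P - E a \<longrightarrow> good (X.word_weight \<delta> n a) x \<omega>)"
    unfolding good_def B_def
    using X.waiting_time_deviation_event[OF less_imp_le[OF \<delta>] n g less_imp_le[OF \<kappa>(1)] \<kappa>(2) ln_word_weight_diff(1)[OF pos], where r=r]
    by (intro choice allI) blast
  then obtain E where E: "\<And>a. E a \<in> X.events" "\<And>a. X.prob (E a) \<le> B"
    "\<And>a x \<omega>. (\<forall>i\<in>{1..n}. x (real i * \<delta>) = a i) \<Longrightarrow> \<omega> \<in> space P - E a \<Longrightarrow> good (X.word_weight \<delta> n a) x \<omega>"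
    by blast
  have "\<exists>E. \<forall>a. E a \<in> Y.events \<and> Y.prob (E a) \<le> B \<and>
      (\<forall>x \<omega>. (\<forall>i\<in>{1..n}. x (real i * \<delta>) = a i) \<longrightarrow> \<omega> \<in> space P' - E a \<longrightarrow> good (Y.word_weight \<delta> n a) x \<omega>)"
    unfolding good_def B_def
    using Y.waiting_time_deviation_event[OF less_imp_le[OF \<delta>] n g less_imp_le[OF \<kappa>(1)] \<kappa>(3) ln_word_weight_diff(2)[OF pos], where r=r]
    by (intro choice allI) blast
  then obtain E' where E': "\<And>a. E' a \<in> Y.events" "\<And>a. Y.prob (E' a) \<le> B"
    "\<And>a x \<omega>. (\<forall>i\<in>{1..n}. x (real i * \<delta>) = a i) \<Longrightarrow> \<omega> \<in> space P' - E' a \<Longrightarrow> good (Y.word_weight \<delta> n a) x \<omega>"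
    by blast
  have times: "measure (P' \<Otimes>\<^sub>M P) (E' a \<times> space P) = Y.prob (E' a)"
    "measure (P' \<Otimes>\<^sub>M P) (space P' \<times> E a) = X.prob (E a)" for a
    using E(1) E'(1) by (simp_all add: measure_def X.emeasure_pair_measure_Times enn2real_mult X.emeasure_space_1 Y.emeasure_space_1)
  \<comment> \<open>\<open>A1\<close> concerns \<open>(x, y)\<close> and \<open>A2\<close> concerns
    \<open>(x, x')\<close>; the remaining coordinate is unconstrained. In both, the word of
    \<open>x\<close> selects the exceptional event.\<close>
  define A1 where "A1 = (\<Union>a\<in>S. {x \<in> space P. h x = a} \<times> (E' a \<times> space P))"
  define A2 where "A2 = (\<Union>a\<in>S. {x \<in> space P. h x = a} \<times> (space P' \<times> E a))"
  have A1: "A1 \<in> sets ?MM" "measure ?MM A1 \<le> B"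
    unfolding A1_def using E' times B0
    by (intro pair_prob_fiber_le S h_ev X.prob_space_axioms YX.prob_space_axioms; simp)+
  have A2: "A2 \<in> sets ?MM" "measure ?MM A2 \<le> B"
    unfolding A2_def using E times B0
    by (intro pair_prob_fiber_le S h_ev X.prob_space_axioms YX.prob_space_axioms; simp)+
  let ?mean = "\<Sum>x\<in>UNIV. pmf \<mu> x * (\<Sum>y\<in>UNIV. R \<delta> x y * f x y)"
  define D where "D = {\<omega> \<in> space P. r \<le>
    \<bar>(\<Sum>i<n - 1. f (\<omega> (real (Suc i) * \<delta>)) (\<omega> (real (Suc (Suc i)) * \<delta>))) - real (n - 1) * ?mean\<bar>}"
  have r0: "0 < r" unfolding r using \<epsilon> \<delta> n by simp
  have Suc_g: "1 \<le> Suc g" by simp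
  \<comment> \<open>The gap serves a second time here: \<open>Suc g\<close> grid steps are also the
    block length over which correlations contract.\<close>
  note D = X.prob_step_sum_deviation[OF less_imp_le[OF \<delta>] Suc_g \<kappa>(2) \<kappa>(1) M b r0, of "n - 1", folded D_def]
  have M0: "0 \<le> M" using M[of undefined undefined] by linarith
  have b0: "0 \<le> b" using \<delta>
    by (intro order_trans[OF _ b[of undefined]] sum_nonneg mult_nonneg_nonneg X.R_nonneg) auto
  have "X.prob D \<le> real (n - 1) * (4 * M * b + 8 * b\<^sup>2 * real (Suc g) / \<kappa>) / r\<^sup>2" by (rule D(2))
  also have "\<dots> \<le> real n * (4 * M * b + 8 * b\<^sup>2 * real (Suc g) / \<kappa>) / r\<^sup>2"
    using M0 b0 \<kappa> by (intro divide_right_mono mult_right_mono) auto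
  finally have PD: "X.prob D \<le> real n * (4 * M * b + 8 * b\<^sup>2 * real (Suc g) / \<kappa>) / r\<^sup>2" .
  define A3 where "A3 = D \<times> space (P' \<Otimes>\<^sub>M P)"
  have A3: "A3 \<in> sets ?MM" "measure ?MM A3 = X.prob D"
    using D(1) by (simp_all add: A3_def measure_def YX.emeasure_pair_measure_Times enn2real_mult YX.emeasure_space_1)
  have "{\<omega> \<in> space ?MM. V \<omega> = \<infinity> \<or> W \<omega> = \<infinity> \<or>
      \<bar>1 / (real n * \<delta>) * ln (real (the_enat (V \<omega>)) / real (the_enat (W \<omega>))) - s\<bar> > \<epsilon>} \<subseteq> A1 \<union> A2 \<union> A3"
  proof (rule subsetI, rule ccontr)
    fix \<omega> assume \<omega>: "\<omega> \<in> {\<omega> \<in> space ?MM. V \<omega> = \<infinity> \<or> W \<omega> = \<infinity> \<or>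
      \<bar>1 / (real n * \<delta>) * ln (real (the_enat (V \<omega>)) / real (the_enat (W \<omega>))) - s\<bar> > \<epsilon>}"
      and nA: "\<omega> \<notin> A1 \<union> A2 \<union> A3"
    obtain x y x' where xyx: "\<omega> = (x, y, x')" by (cases \<omega>) auto
    have sp: "x \<in> space P" "y \<in> space P'" "x' \<in> space P"
      using \<omega> by (auto simp: xyx space_pair_measure)
    have hx: "\<forall>i\<in>{1..n}. x (real i * \<delta>) = h x i" by (simp add: h_def)
    have "y \<notin> E' (h x)" using nA sp hS[of x] by (auto simp: A1_def xyx)
    then have gV: "good (Y.word_weight \<delta> n (h x)) x y" using E'(3)[OF hx] sp by blast
    have "x' \<notin> E (h x)" using nA sp hS[of x] by (auto simp: A2_def xyx)
    then have gW: "good (X.word_weight \<delta> n (h x)) x x'" using E(3)[OF hx] sp by blast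
    have "x \<notin> D" using nA sp by (auto simp: A3_def xyx space_pair_measure)
    then have dev: "\<bar>(\<Sum>i<n - 1. f (x (real (Suc i) * \<delta>)) (x (real (Suc (Suc i)) * \<delta>))) - real (n - 1) * ?mean\<bar> < r"
      using sp by (simp add: D_def not_le)
    have "ln (X.word_weight \<delta> n (h x)) - ln (Y.word_weight \<delta> n (h x)) =
      ln (pmf \<mu> (h x 1) / pmf \<mu>' (h x 1)) + (\<Sum>i<n - 1. f (h x (Suc i)) (h x (Suc (Suc i))))"
      unfolding f by (rule ln_word_weight_diff(3)[OF pos])
    also have "(\<Sum>i<n - 1. f (h x (Suc i)) (h x (Suc (Suc i)))) =
        (\<Sum>i<n - 1. f (x (real (Suc i) * \<delta>)) (x (real (Suc (Suc i)) * \<delta>)))"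
      by (intro sum.cong refl) (auto simp: h_def)
    finally have diff: "ln (X.word_weight \<delta> n (h x)) - ln (Y.word_weight \<delta> n (h x)) =
      ln (pmf \<mu> (h x 1) / pmf \<mu>' (h x 1)) + (\<Sum>i<n - 1. f (x (real (Suc i) * \<delta>)) (x (real (Suc (Suc i)) * \<delta>)))" .
    let ?v = "real (the_enat (waiting_time \<delta> n x y))" and ?w = "real (the_enat (waiting_time \<delta> n x x'))"
    have fin: "waiting_time \<delta> n x y \<noteq> \<infinity>" "waiting_time \<delta> n x x' \<noteq> \<infinity>" "0 < ?v" "0 < ?w"
      and lnV: "\<bar>ln ?v + ln (Y.word_weight \<delta> n (h x))\<bar> \<le> r"
      and lnW: "\<bar>ln ?w + ln (X.word_weight \<delta> n (h x))\<bar> \<le> r"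
      using gV gW by (auto simp: good_def)
    have "ln (?v / ?w) = ln ?v - ln ?w" using fin by (simp add: ln_div)
    then have "\<bar>ln (?v / ?w) - real n * \<delta> * s\<bar> \<le> 5 * r"
      using lnV lnW dev diff init[of "h x 1"] mean
      by (smt (verit))
    then have "\<bar>ln (?v / ?w) - real n * \<delta> * s\<bar> \<le> \<epsilon> * (real n * \<delta>)" by (simp add: r)
    moreover have "1 / (real n * \<delta>) * ln (?v / ?w) - s = (ln (?v / ?w) - real n * \<delta> * s) / (real n * \<delta>)"
      using \<delta> n by (simp add: field_simps)
    ultimately have "\<bar>1 / (real n * \<delta>) * ln (?v / ?w) - s\<bar> \<le> \<epsilon>"
      using \<delta> n by (simp add: abs_divide abs_mult divide_le_eq mult.commute)
    then show False using \<omega> fin by (auto simp: xyx V_def W_def)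
  qed
  \<comment> \<open>Monotonicity of the measure requires measurability of the covering union
    only.\<close>
  then have "measure ?MM {\<omega> \<in> space ?MM. V \<omega> = \<infinity> \<or> W \<omega> = \<infinity> \<or>
      \<bar>1 / (real n * \<delta>) * ln (real (the_enat (V \<omega>)) / real (the_enat (W \<omega>))) - s\<bar> > \<epsilon>} \<le> measure ?MM (A1 \<union> A2 \<union> A3)"
    using A1 A2 A3 by (intro XYX.finite_measure_mono) auto
  also have "\<dots> \<le> measure ?MM A1 + measure ?MM A2 + measure ?MM A3"
    using measure_Un_le[of "A1 \<union> A2" ?MM A3] measure_Un_le[of A1 ?MM A2] A1 A2 A3 by auto
  also have "\<dots> \<le> 2 * B + real n * (4 * M * b + 8 * b\<^sup>2 * real (Suc g) / \<kappa>) / r\<^sup>2"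
    using A1 A2 A3 PD by simp
  finally show ?thesis by (simp add: B_def)
qed

end

section \<open>The log-likelihood ratio for small time steps\<close>

text \<open>Differentiate the stationarity identity at time 0. It is stated for nonnegative times,
  so the derivative is evaluated as a limit from the right.\<close>

lemma stationary_generator_balance:
  fixes p :: "'a::finite \<Rightarrow> 'a pmf"
  assumes c: "\<forall>x. 0 < c x" and st: "stationary (generator p c) \<mu>"
  shows "(\<Sum>x\<in>UNIV. pmf \<mu> x * generator p c (indicator {y}) x) = 0"
proof -
  let ?F = "\<lambda>t. \<Sum>x\<in>UNIV. pmf \<mu> x * transition_prob (generator p c) t x y"
  have const: "?F t = pmf \<mu> y" if "0 \<le> t" for t
    using st that by (simp add: stationary_def)
  have "(?F has_real_derivative (\<Sum>x\<in>UNIV. pmf \<mu> x * generator p c (indicator {y}) x)) (at 0)"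
    by (intro DERIV_sum DERIV_cmult transition_prob_has_derivative_0 c)
  then have "((\<lambda>t. (?F (0 + t) - ?F 0) / t) \<longlongrightarrow> (\<Sum>x\<in>UNIV. pmf \<mu> x * generator p c (indicator {y}) x)) (at_right 0)"
    unfolding DERIV_def by (rule filterlim_mono[OF _ order_refl at_le]) simp
  moreover have "((\<lambda>t. (?F (0 + t) - ?F 0) / t) \<longlongrightarrow> 0) (at_right 0)"
    by (rule tendsto_eventually)
      (rule eventually_mono[OF eventually_at_right_less[of 0]], simp add: const)
  ultimately show ?thesis by (rule tendsto_unique[OF trivial_limit_at_right_real])
qed

text \<open>If a state had weight 0, its outflow would vanish, so by the balance equation its inflow
  would vanish as well. Hence positivity spreads along the edges of \<open>p\<close>, and by
  irreducibility from one state of the support to all states.\<close>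

lemma stationary_pos:
  fixes p :: "'a::finite \<Rightarrow> 'a pmf"
  assumes irr: "irreducible_chain p" and px: "\<And>x. pmf (p x) x = 0"
    and c: "\<forall>x. 0 < c x" and st: "stationary (generator p c) \<mu>"
  shows "0 < pmf \<mu> y"
proof -
  have step: "0 < pmf \<mu> y" if "0 < pmf \<mu> x" "0 < pmf (p x) y" for x y
  proof (rule ccontr)
    assume "\<not> 0 < pmf \<mu> y"
    then have y0: "pmf \<mu> y = 0" using pmf_nonneg[of \<mu> y] by linarith
    have "x \<noteq> y" using that px[of x] by auto
    then have "0 < pmf \<mu> x * generator p c (indicator {y}) x"
      using that c px by (simp add: generator_indicator)
    moreover have "0 \<le> pmf \<mu> z * generator p c (indicator {y}) z" for z
      using c px[of z] y0 by (auto simp: generator_indicator less_imp_le)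
    ultimately have "0 < (\<Sum>x\<in>UNIV. pmf \<mu> x * generator p c (indicator {y}) x)"
      by (intro sum_pos2[of _ x]) auto
    then show False using stationary_generator_balance[OF c st] by simp
  qed
  have reach: "0 < pmf \<mu> y" if "0 < pmf \<mu> x" "0 < pmf (n_step p n x) y" for n x
    using that
  proof (induction n arbitrary: x)
    case 0
    then show ?case by (simp add: n_step_def indicator_def split: if_splits)
  next
    case (Suc n)
    then show ?case using step pmf_n_step_Suc_pos_iff by metis
  qed
  obtain x where "x \<in> set_pmf \<mu>" using set_pmf_not_empty[of \<mu>] by blast
  then have "0 < pmf \<mu> x" by (simp add: pmf_positive)
  moreover obtain n where "0 < pmf (n_step p n x) y" using irr by (auto simp: irreducible_chain_def)
  ultimately show ?thesis by (rule reach)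
qed

lemma stationary_markov_path_law:
  fixes p :: "'a::finite \<Rightarrow> 'a pmf"
  assumes "irreducible_chain p" "\<And>x. pmf (p x) x = 0" "\<forall>x. 0 < c x"
    and st: "stationary (generator p c) \<mu>" and law: "markov_path_law (generator p c) \<mu> P"
  shows "stationary_markov P \<mu> (transition_prob (generator p c))"
proof -
  interpret prob_space P using law by (simp add: markov_path_law_def)
  have sets: "sets P = sets path_space" using law by (simp add: markov_path_law_def)
  show ?thesis
  proof
    show "(\<lambda>\<omega>. \<omega> t) \<in> measurable P (count_space UNIV)" if "0 \<le> t" for t :: real
      unfolding measurable_cong_sets[OF sets refl] path_space_def using that
      by (intro measurable_restrict_space1 measurable_component_singleton) auto
    show "prob {\<omega> \<in> space P. \<forall>i\<le>n. \<omega> (s i) = x i} =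
        pmf \<mu> (x 0) * (\<Prod>i<n. transition_prob (generator p c) (s (Suc i) - s i) (x i) (x (Suc i)))"
      if "s 0 = 0" "\<And>i. i < n \<Longrightarrow> s i \<le> s (Suc i)" for s n x
      using law that unfolding markov_path_law_def by blast
    show "(\<Sum>x\<in>UNIV. pmf \<mu> x * transition_prob (generator p c) t x y) = pmf \<mu> y" if "0 \<le> t" for t y
      using st that by (simp add: stationary_def)
    show "0 < pmf \<mu> z" for z using stationary_pos assms by metis
  qed
qed

text \<open>Both constants exceed the corresponding limits by at least 1, so that the strict
  inequalities hold eventually; finiteness of the state space makes them uniform in the
  states.\<close>

lemma log_ratio_bounds:
  fixes p :: "'a::finite \<Rightarrow> 'a pmf"
  assumes irr: "irreducible_chain p" and px: "\<And>x. pmf (p x) x = 0"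
    and c: "\<forall>x. 0 < c x" "\<forall>x. 0 < c' x"
  obtains M B where "\<forall>\<^sub>F t in at_right 0. \<forall>x y. \<bar>log_ratio p c c' t x y\<bar> \<le> M"
    and "\<forall>\<^sub>F t in at_right 0. \<forall>x. (\<Sum>y\<in>UNIV. transition_prob (generator p c) t x y * \<bar>log_ratio p c c' t x y\<bar>) \<le> B * t"
proof
  define l where "l x y = ln (gen_coeff p c x y (chain_dist p x y) / gen_coeff p c' x y (chain_dist p x y))" for x y
  define M where "M = Max (range (\<lambda>(x, y). \<bar>l x y\<bar>)) + 1"
  have "\<forall>\<^sub>F t in at_right 0. \<bar>log_ratio p c c' t x y\<bar> \<le> M" for x y
  proof -
    have "\<bar>l x y\<bar> \<le> Max (range (\<lambda>(x, y). \<bar>l x y\<bar>))" by (rule Max_ge) (auto intro!: image_eqI[of _ _ "(x, y)"])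
    then have "\<bar>l x y\<bar> < M" by (simp add: M_def)
    with tendsto_rabs[OF tendsto_log_ratio[OF irr c, of x y]]
    have "\<forall>\<^sub>F t in at_right 0. \<bar>log_ratio p c c' t x y\<bar> < M" unfolding l_def by (rule order_tendstoD)
    then show ?thesis by (rule eventually_mono) simp
  qed
  then show "\<forall>\<^sub>F t in at_right 0. \<forall>x y. \<bar>log_ratio p c c' t x y\<bar> \<le> M" by (simp add: eventually_all_finite)
  define k where "k x y = (if x = y then c' x - c x else c x * pmf (p x) y * ln (c x / c' x))" for x y
  define B where "B = Max (range (\<lambda>x. \<Sum>y\<in>UNIV. \<bar>k x y\<bar>)) + 1"
  have "\<forall>\<^sub>F t in at_right 0. (\<Sum>y\<in>UNIV. transition_prob (generator p c) t x y * \<bar>log_ratio p c c' t x y\<bar>) \<le> B * t" for x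
  proof -
    have "(\<Sum>y\<in>UNIV. \<bar>k x y\<bar>) \<le> Max (range (\<lambda>x. \<Sum>y\<in>UNIV. \<bar>k x y\<bar>))" by (rule Max_ge) auto
    then have "(\<Sum>y\<in>UNIV. \<bar>k x y\<bar>) < B" unfolding B_def by linarith
    moreover have "((\<lambda>t. \<Sum>y\<in>UNIV. \<bar>transition_prob (generator p c) t x y * log_ratio p c c' t x y / t\<bar>)
        \<longlongrightarrow> (\<Sum>y\<in>UNIV. \<bar>k x y\<bar>)) (at_right 0)"
      unfolding k_def by (intro tendsto_sum tendsto_rabs tendsto_transition_log_ratio irr c px)
    ultimately have "\<forall>\<^sub>F t in at_right 0. (\<Sum>y\<in>UNIV. \<bar>transition_prob (generator p c) t x y * log_ratio p c c' t x y / t\<bar>) < B"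
      by (rule order_tendstoD(2)[rotated])
    then show ?thesis
      using eventually_at_right_less[of 0] eventually_transition_prob_pos[OF irr c(1)]
    proof eventually_elim
      case (elim t)
      then have "(\<Sum>y\<in>UNIV. \<bar>transition_prob (generator p c) t x y * log_ratio p c c' t x y / t\<bar>) =
          (\<Sum>y\<in>UNIV. transition_prob (generator p c) t x y * \<bar>log_ratio p c c' t x y\<bar>) / t"
        by (simp add: abs_mult sum_divide_distrib abs_of_pos)
      with elim show ?case by (simp add: divide_less_eq)
    qed
  qed
  then show "\<forall>\<^sub>F t in at_right 0. \<forall>x. (\<Sum>y\<in>UNIV. transition_prob (generator p c) t x y * \<bar>log_ratio p c c' t x y\<bar>) \<le> B * t"
    by (simp add: eventually_all_finite)
qed

text \<open>Off the diagonal the weights \<open>pmf (p x) y\<close> sum to 1 and leave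
  \<open>c x * ln (c x / c' x)\<close>; the diagonal, where \<open>p\<close> vanishes, supplies
  \<open>c' x - c x\<close>.\<close>

lemma tendsto_mean_log_ratio:
  fixes p :: "'a::finite \<Rightarrow> 'a pmf"
  assumes irr: "irreducible_chain p" and px: "\<And>x. pmf (p x) x = 0"
    and c: "\<forall>x. 0 < c x" "\<forall>x. 0 < c' x"
  shows "((\<lambda>t. (\<Sum>x\<in>UNIV. pmf \<mu> x * (\<Sum>y\<in>UNIV. transition_prob (generator p c) t x y * log_ratio p c c' t x y)) / t)
    \<longlongrightarrow> relative_entropy_rate \<mu> c c') (at_right 0)"
proof -
  let ?k = "\<lambda>x y. if x = y then c' x - c x else c x * pmf (p x) y * ln (c x / c' x)"
  have "((\<lambda>t. \<Sum>x\<in>UNIV. pmf \<mu> x * (\<Sum>y\<in>UNIV. transition_prob (generator p c) t x y * log_ratio p c c' t x y / t))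
    \<longlongrightarrow> (\<Sum>x\<in>UNIV. pmf \<mu> x * (\<Sum>y\<in>UNIV. ?k x y))) (at_right 0)"
    by (intro tendsto_intros tendsto_transition_log_ratio irr c px)
  moreover have "(\<Sum>y\<in>UNIV. ?k x y) = c x * ln (c x / c' x) - (c x - c' x)" for x
  proof -
    have "?k x y = (if y = x then c' x - c x else 0) + pmf (p x) y * (c x * ln (c x / c' x))" for y
      using px[of x] by auto
    then have "(\<Sum>y\<in>UNIV. ?k x y) = (\<Sum>y\<in>UNIV. (if y = x then c' x - c x else 0) + pmf (p x) y * (c x * ln (c x / c' x)))"
      by simp
    then show ?thesis by (simp add: sum.distrib sum_pmf_eq_1 flip: sum_distrib_right)
  qed
  then have "(\<Sum>x\<in>UNIV. pmf \<mu> x * (\<Sum>y\<in>UNIV. ?k x y)) = relative_entropy_rate \<mu> c c'"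
    by (simp add: relative_entropy_rate_def right_diff_distrib sum_subtractf mult.assoc)
  ultimately show ?thesis by (simp flip: sum_divide_distrib)
qed

section \<open>Choice of the scales and passage to the limit\<close>

theorem theorem3:
  fixes p :: "'a::finite \<Rightarrow> 'a pmf"
    and c c' :: "'a \<Rightarrow> real"
    and \<mu> \<mu>' :: "'a pmf"
    and P P' :: "(real \<Rightarrow> 'a) measure"
    and \<delta> :: "nat \<Rightarrow> real"
  assumes "irreducible_chain p"
    and "\<And>x. pmf (p x) x = 0"
    and "\<And>x. c x > 0"
    and "\<And>x. c' x > 0"
    and "stationary (generator p c) \<mu>"
    and "stationary (generator p c') \<mu>'"
    and "markov_path_law (generator p c) \<mu> P"
    and "markov_path_law (generator p c') \<mu>' P'"
    and "\<And>n. n \<ge> 1 \<Longrightarrow> \<delta> n > 0"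
    and "\<delta> \<longlonglongrightarrow> 0"
    and "(\<lambda>n. ln (real n) / (real n * (\<delta> n)\<^sup>2)) \<longlonglongrightarrow> 0"
  shows "log_ratio_tendsto_in_prob (P \<Otimes>\<^sub>M P' \<Otimes>\<^sub>M P) (\<lambda>n. 1 / (real n * \<delta> n))
           (\<lambda>n (x, y, x'). waiting_time (\<delta> n) n x y)
           (\<lambda>n (x, y, x'). waiting_time (\<delta> n) n x x')
           (relative_entropy_rate \<mu> c c')"
proof -
  note irr = assms(1) and px = assms(2) and \<delta>0 = assms(10)
  have c: "\<forall>x. 0 < c x" "\<forall>x. 0 < c' x" using assms by auto
  let ?R = "transition_prob (generator p c)" and ?R' = "transition_prob (generator p c')"
  interpret X: stationary_markov P \<mu> ?R by (rule stationary_markov_path_law[OF irr px c(1) assms(5,7)])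
  interpret Y: stationary_markov P' \<mu>' ?R' by (rule stationary_markov_path_law[OF irr px c(2) assms(6,8)])
  interpret two_stationary_markov P P' \<mu> \<mu>' ?R ?R' ..
  interpret YX: pair_prob_space P' P ..
  interpret XYX: pair_prob_space P "P' \<Otimes>\<^sub>M P" ..
  define s where "s = relative_entropy_rate \<mu> c c'"
  define N where "N n = real n * \<delta> n" for n
  have \<delta>_pos: "\<forall>\<^sub>F n in sequentially. 0 < \<delta> n" using assms(9) by (auto simp: eventually_sequentially)
  have \<delta>_right: "filterlim \<delta> (at_right 0) sequentially"
    by (rule tendsto_imp_filterlim_at_right[OF \<delta>0 \<delta>_pos])
  note along = eventually_compose_filterlim[OF _ \<delta>_right]

  \<comment> \<open>The rate assumption multiplied by \<open>\<delta> n\<close>, which tends to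
    0.\<close>
  have lnN: "(\<lambda>n. ln (real n) / N n) \<longlonglongrightarrow> 0"
  proof (rule Lim_transform_eventually)
    show "(\<lambda>n. \<delta> n * (ln (real n) / (real n * (\<delta> n)\<^sup>2))) \<longlonglongrightarrow> 0"
      using tendsto_mult[OF \<delta>0 assms(11)] by simp
    show "\<forall>\<^sub>F n in sequentially. \<delta> n * (ln (real n) / (real n * (\<delta> n)\<^sup>2)) = ln (real n) / N n"
      using \<delta>_pos by eventually_elim (simp add: N_def power2_eq_square)
  qed
  have N_pos: "\<forall>\<^sub>F n in sequentially. 0 < N n"
    using \<delta>_pos eventually_gt_at_top[of 0] by eventually_elim (simp add: N_def)
  \<comment> \<open>From \<open>n = 3\<close> on, \<open>ln (real n)\<close> is at least 1, so the
    previous limit forces \<open>N n\<close> to infinity.\<close>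
  have invN: "(\<lambda>n. inverse (N n)) \<longlonglongrightarrow> 0"
  proof (rule tendsto_sandwich[OF _ _ tendsto_const lnN])
    show "\<forall>\<^sub>F n in sequentially. 0 \<le> inverse (N n)" using N_pos by eventually_elim simp
    show "\<forall>\<^sub>F n in sequentially. inverse (N n) \<le> ln (real n) / N n"
      using N_pos eventually_ge_at_top[of 3]
    proof eventually_elim
      case (elim n)
      have "exp 1 \<le> (3 :: real)" using exp_le by simp
      then have "1 \<le> ln (real n)" using elim by (subst ln_ge_iff) auto
      then show ?case using elim by (simp add: divide_simps)
    qed
  qed
  have N_top: "filterlim N at_top sequentially"
    using filterlim_inverse_at_top[OF invN] N_pos by simp

  \<comment> \<open>A fixed time, chosen once for both chains and independent of
    \<open>n\<close>.\<close>
  obtain u where u: "0 < u" "\<And>x y. 0 < ?R u x y" "\<And>x y. 0 < ?R' u x y"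
  proof -
    have "\<forall>\<^sub>F t in at_right 0. 0 < t \<and> (\<forall>x y. 0 < ?R t x y) \<and> (\<forall>x y. 0 < ?R' t x y)"
      by (intro eventually_conj eventually_at_right_less eventually_transition_prob_pos irr c)
    then show ?thesis using that eventually_happens'[OF trivial_limit_at_right_real] by blast
  qed
  obtain \<kappa>1 where \<kappa>1: "0 < \<kappa>1" "\<And>t x y. u \<le> t \<Longrightarrow> \<kappa>1 \<le> ?R t x y"
    by (rule X.positive_lower_bound[OF u(1,2)]) (rule that)
  obtain \<kappa>2 where \<kappa>2: "0 < \<kappa>2" "\<And>t x y. u \<le> t \<Longrightarrow> \<kappa>2 \<le> ?R' t x y"
    by (rule Y.positive_lower_bound[OF u(1,3)]) (rule that)
  define \<kappa> where "\<kappa> = min \<kappa>1 \<kappa>2"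
  have \<kappa>: "0 < \<kappa>" "\<And>t x y. u \<le> t \<Longrightarrow> \<kappa> \<le> ?R t x y" "\<And>t x y. u \<le> t \<Longrightarrow> \<kappa> \<le> ?R' t x y"
    using \<kappa>1 \<kappa>2 unfolding \<kappa>_def by (auto intro: min.coboundedI1 min.coboundedI2)
  obtain M B where M: "\<forall>\<^sub>F t in at_right 0. \<forall>x y. \<bar>log_ratio p c c' t x y\<bar> \<le> M"
    and B: "\<forall>\<^sub>F t in at_right 0. \<forall>x. (\<Sum>y\<in>UNIV. ?R t x y * \<bar>log_ratio p c c' t x y\<bar>) \<le> B * t"
    by (rule log_ratio_bounds[OF irr px c])
  define mean where "mean t = (\<Sum>x\<in>UNIV. pmf \<mu> x * (\<Sum>y\<in>UNIV. ?R t x y * log_ratio p c c' t x y))" for t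
  have mean: "(\<lambda>n. mean (\<delta> n) / \<delta> n) \<longlonglongrightarrow> s"
    unfolding mean_def s_def
    by (rule filterlim_compose[OF tendsto_mean_log_ratio[OF irr px c] \<delta>_right])
  define C0 where "C0 = Max (range (\<lambda>x. \<bar>ln (pmf \<mu> x / pmf \<mu>' x)\<bar>))"
  have C0: "\<bar>ln (pmf \<mu> x / pmf \<mu>' x)\<bar> \<le> C0" for x unfolding C0_def by (rule Max_ge) auto

  show ?thesis
    unfolding log_ratio_tendsto_in_prob_def s_def[symmetric]
  proof (intro allI impI)
    fix \<epsilon> :: real assume \<epsilon>: "0 < \<epsilon>"
    define r where "r n = \<epsilon> * N n / 5" for n
    \<comment> \<open>The factor \<open>25 / \<epsilon>\<^sup>2\<close> comes from the division by
      \<open>(r n)\<^sup>2\<close>, and \<open>u + 2\<close> bounds the gap duration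
      \<open>real (Suc g) * \<delta> n\<close>.\<close>
    define C where "C = (4 * M * B + 8 * B\<^sup>2 * (u + 2) / \<kappa>) * (25 / \<epsilon>\<^sup>2)"
    \<comment> \<open>Here \<open>n + g\<close> is replaced by its bound
      \<open>(u + 3) * real n\<close>, and the factor \<open>real n\<close> is moved into the
      exponent.\<close>
    define bound where "bound n = 2 * (exp (- r n) + exp (- \<kappa> * (exp (r n - ln (real n)) / (u + 3) - 1))) + C * inverse (N n)" for n
    have r_top: "filterlim r at_top sequentially"
    proof -
      have "filterlim (\<lambda>n. \<epsilon> / 5 * N n) at_top sequentially"
        using \<epsilon> by (intro filterlim_tendsto_pos_mult_at_top[OF tendsto_const _ N_top]) simp
      then show ?thesis by (simp add: r_def[abs_def])
    qed
    have rln_top: "filterlim (\<lambda>n. r n - ln (real n)) at_top sequentially"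
    proof -
      have "filterlim (\<lambda>n. (\<epsilon> / 5 - ln (real n) / N n) * N n) at_top sequentially"
        using \<epsilon> tendsto_diff[OF tendsto_const lnN, of "\<epsilon> / 5"]
        by (intro filterlim_tendsto_pos_mult_at_top[OF _ _ N_top, of _ "\<epsilon> / 5"]) auto
      then show ?thesis
        by (rule filterlim_mono_eventually[OF _ order_refl order_refl])
          (use N_pos in \<open>eventually_elim, simp add: r_def left_diff_distrib\<close>)
    qed
    have "bound \<longlonglongrightarrow> 2 * (0 + 0) + C * 0"
      unfolding bound_def[abs_def]
    proof (intro tendsto_add tendsto_mult tendsto_const invN)
      show "(\<lambda>n. exp (- r n)) \<longlonglongrightarrow> 0"
        using r_top unfolding filterlim_uminus_at_top by (rule filterlim_compose[OF exp_at_bot])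
      have "filterlim (\<lambda>n. - 1 + 1 / (u + 3) * exp (r n - ln (real n))) at_top sequentially"
        using u(1) by (intro filterlim_tendsto_add_at_top[OF tendsto_const]
          filterlim_tendsto_pos_mult_at_top[OF tendsto_const] filterlim_compose[OF exp_at_top rln_top]) auto
      then have "filterlim (\<lambda>n. \<kappa> * (- 1 + 1 / (u + 3) * exp (r n - ln (real n)))) at_top sequentially"
        by (rule filterlim_tendsto_pos_mult_at_top[OF tendsto_const \<kappa>(1)])
      then have "filterlim (\<lambda>n. - (\<kappa> * (- 1 + 1 / (u + 3) * exp (r n - ln (real n))))) at_bot sequentially"
        by (simp only: filterlim_uminus_at_top)
      then have "(\<lambda>n. exp (- (\<kappa> * (- 1 + 1 / (u + 3) * exp (r n - ln (real n)))))) \<longlonglongrightarrow> 0"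
        by (rule filterlim_compose[OF exp_at_bot])
      then show "(\<lambda>n. exp (- \<kappa> * (exp (r n - ln (real n)) / (u + 3) - 1))) \<longlonglongrightarrow> 0"
        by (simp add: algebra_simps)
    qed
    then have bound0: "bound \<longlonglongrightarrow> 0" by simp

    \<comment> \<open>A word of \<open>n\<close> letters has \<open>n - 1\<close> transitions while
      the normalization is \<open>real n * \<delta> n\<close>; hence the correction
      \<open>1 - 1 / real n\<close>.\<close>
    have mean_ev: "\<forall>\<^sub>F n in sequentially. \<bar>real (n - 1) * mean (\<delta> n) - real n * \<delta> n * s\<bar> \<le> r n"
    proof -
      have "(\<lambda>n. (1 - 1 / real n) * (mean (\<delta> n) / \<delta> n) - s) \<longlonglongrightarrow> (1 - 0) * s - s"
        by (intro tendsto_intros mean lim_1_over_n)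
      then have "(\<lambda>n. \<bar>(1 - 1 / real n) * (mean (\<delta> n) / \<delta> n) - s\<bar>) \<longlonglongrightarrow> 0"
        using tendsto_rabs_zero by fastforce
      then have "\<forall>\<^sub>F n in sequentially. \<bar>(1 - 1 / real n) * (mean (\<delta> n) / \<delta> n) - s\<bar> < \<epsilon> / 5"
        using \<epsilon> by (intro order_tendstoD) auto
      then show ?thesis using N_pos \<delta>_pos eventually_ge_at_top[of 1]
      proof eventually_elim
        case (elim n)
        have "real (n - 1) * mean (\<delta> n) - real n * \<delta> n * s = N n * ((1 - 1 / real n) * (mean (\<delta> n) / \<delta> n) - s)"
          using elim by (simp add: N_def of_nat_diff field_simps)
        then have "\<bar>real (n - 1) * mean (\<delta> n) - real n * \<delta> n * s\<bar> = N n * \<bar>(1 - 1 / real n) * (mean (\<delta> n) / \<delta> n) - s\<bar>"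
          using elim by (simp add: abs_mult)
        also have "\<dots> \<le> N n * (\<epsilon> / 5)" using elim by (intro mult_left_mono) auto
        finally show ?case by (simp add: r_def mult.commute)
      qed
    qed
    have C0_ev: "\<forall>\<^sub>F n in sequentially. C0 \<le> r n"
      using r_top by (simp add: filterlim_at_top)
    have N1: "\<forall>\<^sub>F n in sequentially. 1 \<le> N n" using N_top by (simp add: filterlim_at_top)
    have \<delta>1: "\<forall>\<^sub>F n in sequentially. \<delta> n < 1" using \<delta>0 by (rule order_tendstoD) simp

    let ?MM = "P \<Otimes>\<^sub>M P' \<Otimes>\<^sub>M P"
    let ?V = "\<lambda>n (x, y, x'). waiting_time (\<delta> n) n x y"
    let ?W = "\<lambda>n (x, y, x'). waiting_time (\<delta> n) n x x'"
    let ?bad = "\<lambda>n. {\<omega> \<in> space ?MM. ?V n \<omega> = \<infinity> \<or> ?W n \<omega> = \<infinity> \<or>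
        \<bar>1 / (real n * \<delta> n) * ln (real (the_enat (?V n \<omega>)) / real (the_enat (?W n \<omega>))) - s\<bar> > \<epsilon>}"
    have "\<forall>\<^sub>F n in sequentially. measure ?MM (?bad n) \<le> bound n"
      using along[OF eventually_transition_prob_pos[OF irr c(1)]]
        along[OF eventually_transition_prob_pos[OF irr c(2)]] along[OF M] along[OF B]
        \<delta>_pos \<delta>1 N1 C0_ev mean_ev eventually_ge_at_top[of 1]
    proof eventually_elim
      case (elim n)
      \<comment> \<open>The floor plus one makes the gap last at least \<open>u\<close> and secures
        \<open>1 \<le> g\<close>; the overshoot is at most two grid steps, hence at most 2 once
        \<open>\<delta> n < 1\<close>.\<close>
      define g where "g = Suc (nat \<lfloor>u / \<delta> n\<rfloor>)"
      have fl: "real (nat \<lfloor>u / \<delta> n\<rfloor>) \<le> u / \<delta> n" "u / \<delta> n < real (nat \<lfloor>u / \<delta> n\<rfloor>) + 1"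
        using u(1) elim(5) by (simp_all add: of_nat_floor)
      have g1: "1 \<le> g" by (simp add: g_def)
      have "u < (real (nat \<lfloor>u / \<delta> n\<rfloor>) + 1) * \<delta> n" using fl(2) elim(5) by (simp add: divide_less_eq)
      also have "\<dots> \<le> real (Suc g) * \<delta> n" using elim(5) by (intro mult_right_mono) (auto simp: g_def)
      finally have gu: "u \<le> real (Suc g) * \<delta> n" by simp
      have "real (Suc g) * \<delta> n \<le> (u / \<delta> n + 2) * \<delta> n" using fl(1) elim(5) by (intro mult_right_mono) (auto simp: g_def)
      also have "\<dots> \<le> u + 2" using elim(5,6) by (simp add: distrib_right)
      finally have gup: "real (Suc g) * \<delta> n \<le> u + 2" .
      \<comment> \<open>Since \<open>1 \<le> N n\<close>, one unit of time contains at most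
        \<open>n\<close> grid steps, so a gap of bounded duration has O(n) of them.\<close>
      have ng: "real (n + g) \<le> (u + 3) * real n"
      proof -
        have "real g \<le> real g * N n" using elim(7) by (simp add: mult_le_cancel_left1)
        also have "\<dots> = real g * \<delta> n * real n" by (simp add: N_def)
        also have "\<dots> \<le> (u + 2) * real n" using gup elim(5) by (intro mult_right_mono) (auto simp: algebra_simps)
        finally show ?thesis by (simp add: algebra_simps)
      qed
      have main: "measure ?MM (?bad n) \<le> 2 * (exp (- r n) + exp (- \<kappa> * (exp (r n) / real (n + g) - 1)))
        + real n * (4 * M * (B * \<delta> n) + 8 * (B * \<delta> n)\<^sup>2 * real (Suc g) / \<kappa>) / (r n)\<^sup>2"
        by (rule log_ratio_deviation_le[where f="log_ratio p c c' (\<delta> n)"])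
          (use elim g1 \<kappa> gu \<epsilon> order_trans[OF C0 elim(8)] in \<open>auto simp: log_ratio_def mean_def r_def N_def\<close>)
      have windows: "exp (- \<kappa> * (exp (r n) / real (n + g) - 1)) \<le> exp (- \<kappa> * (exp (r n - ln (real n)) / (u + 3) - 1))"
      proof -
        have "exp (r n - ln (real n)) / (u + 3) = exp (r n) / ((u + 3) * real n)"
          using elim(10) by (simp add: exp_diff mult.commute)
        also have "\<dots> \<le> exp (r n) / real (n + g)" using ng elim(10) by (intro divide_left_mono) (auto intro!: mult_pos_pos)
        finally show ?thesis using \<kappa>(1) by (simp add: mult_left_mono)
      qed
      \<comment> \<open>A variance of order \<open>N n\<close> against the squared scale
        \<open>(N n)\<^sup>2\<close> leaves \<open>inverse (N n)\<close>.\<close>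
      have variance: "real n * (4 * M * (B * \<delta> n) + 8 * (B * \<delta> n)\<^sup>2 * real (Suc g) / \<kappa>) / (r n)\<^sup>2 \<le> C * inverse (N n)"
      proof -
        have nz: "real n \<noteq> 0" "\<delta> n \<noteq> 0" using elim by auto
        have "real n * (4 * M * (B * \<delta> n) + 8 * (B * \<delta> n)\<^sup>2 * real (Suc g) / \<kappa>) / (r n)\<^sup>2 =
            (4 * M * B + 8 * B\<^sup>2 * (real (Suc g) * \<delta> n) / \<kappa>) * (25 / \<epsilon>\<^sup>2) * inverse (N n)"
          using nz \<epsilon> \<kappa>(1) by (simp add: r_def N_def field_simps power2_eq_square)
        also have "\<dots> \<le> C * inverse (N n)"
          unfolding C_def using gup \<kappa>(1) elim(7)
          by (intro mult_right_mono add_left_mono divide_right_mono mult_left_mono) auto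
        finally show ?thesis .
      qed
      show ?case unfolding bound_def
        by (rule order_trans[OF main]) (intro add_mono mult_left_mono order_refl windows variance, simp)
    qed
    then show "(\<lambda>n. measure ?MM (?bad n)) \<longlonglongrightarrow> 0"
      by (intro tendsto_sandwich[OF _ _ tendsto_const bound0]) auto
  qed
qed

end
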